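(* Let $f\colon M\to M$ be a north-south diffeomorphism of a sphere $M$ of dimension $k\ge1$, with its hyperbolic bracket $[\cdot,\cdot]\colon\Delta_\gamma\to M$ as described in the context. Then the shadowing map $\mathrm{Sh}_f\colon \tilde M(f,\delta)\to M$ induced by this bracket has self-tuning but is not shift-invariant.
   Context: Notation: $\tilde M=M^{\mathbb Z}$; $\sigma$ is the shift on $\tilde M$, $(\sigma(x))_i=x_{i+1}$; $(\mathrm{orb}_f(p))_i=f^i(p)$. Fix $\mu\in(0,1)$ and let $\tilde d_s(x,y)=\sum_{i\in\mathbb Z}\mu^{|i|}d(x_i,y_i)$. For $\delta\ge0$, $\tilde M(f,\delta)=\{x\in\tilde M:d(x_{i+1},f(x_i))\le\delta\ \forall i\in\mathbb Z\}$. $\Delta_\gamma=\{(p,q)\in M^2:d(p,q)\le\gamma\}$. A pseudo-orbit map is a continuous map $\mathrm{Sh}_f\colon\tilde M(f,\delta)\to M$ with $\mathrm{Sh}_f(\mathrm{orb}_f(p))=p$ for all $p\in M$. It has self-tuning if for all $\epsilon>0$ there is $\eta>0$ such that if $\tilde d_s(\sigma^i(x),\mathrm{orb}_f(x_i))<\eta$ for some $x\in\tilde M(f,\delta)$, $i\in\mathbb Z$, then $d(f^i(\mathrm{Sh}_f(x)),\mathrm{Sh}_f(\sigma^i(x)))\le\epsilon$. It is shift-invariant if for some $\delta'\in(0,\delta]$ one has $\mathrm{Sh}_f\circ\sigma=f\circ\mathrm{Sh}_f$ on $\tilde M(f,\delta')$. North-south dynamics: $f$ is a diffeomorphism with two distinct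 hyperbolic fixed points $N,S\in M$, and for every $p\in M\setminus\{N,S\}$, $f^n(p)\to S$ and $f^{-n}(p)\to N$ as $n\to+\infty$. $M$ carries a Riemannian metric with distance $d$ for which there are $r>0$ and $\lambda\in(0,1)$ such that the balls $B_r(N)$, $B_r(S)$ have disjoint closures, $d(f^n(p),f^n(q))\le\lambda^nd(p,q)$ for all $p,q\in B_r(S)$, $n\ge0$, and $d(f^{-n}(p),f^{-n}(q))\le\lambda^nd(p,q)$ for all $p,q\in B_r(N)$, $n\ge0$. Let $L$ be a Lipschitz constant for both $f$ and $f^{-1}$. The bracket: let $\varphi\colon M\to\{t\in\mathbb R:0\le t\le1\}$ be continuous with $\varphi=1$ on $B_r(N)$ and $\varphi=0$ on $B_r(S)$. Let $\rho>0$ be such that $\exp_p$ is injective on $\{v\in T_pM:\|v\|\le\rho\}$ for all $p$. For $d(p,q)\le\rho$ let $[p,q]=\exp_p(\varphi(p)\exp_p^{-1}(q))$ (inverse of the restricted exponential). Let $0<\gamma<\min\{r,\rho\}$ be such that, with $U=\{p:d(p,N)>r-\gamma,\ d(p,S)>r-\gamma\}$, for $p,q\in U$ with $d(p,q)\le\gamma$ the geodesic from $p$ to $q$ (given by the restricted exponential) is disjoint from the $r/2$-balls centered at $N$ and $S$. Let $u\ge1$ be such that $f^i(p),f^i(q),f^i([p,q])\in B_{r/2}(N)\cup B_{r/2}(S)$ for $|i|\ge u$ and all $p,q\in U$ with $d(p,q)\le\gamma$, and $f^u(B_r(N))\cup f^{-u}(B_r(S))=M$. With $c=L^u/\lambda^u$,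 the bracket restricted to $\Delta_\gamma$ is hyperbolic: for $d(p,q)\le\gamma$ and $n\ge0$, $d(f^n([p,q]),f^n(q))\le c\lambda^nd(p,q)$ and $d(f^{-n}([p,q]),f^{-n}(p))\le c\lambda^nd(p,q)$. Induced shadowing map: fix $m\ge1$ with $c\lambda^m\le\frac1{2c}$, put $L_m=1+L+\dots+L^{m-1}$, and take $\delta>0$ with $2\delta L_m\le\gamma$ and small enough that all brackets below are defined (true for every sufficiently small $\delta>0$). For $x\in\tilde M(f,\delta)$ let $q_0=x_0$, $q_n=[f^m(q_{n-1}),x_{nm}]$ for $n\ge1$, and $\mathrm{Sh}_f^+(x)=\lim_{n\to\infty}f^{-nm}(q_n)$. Let $\mathrm{Sh}^-_f(x)$ be obtained by the same procedure with $f^{-1}$ in place of $f$ (applied to the sequence $i\mapsto x_{-i}$ and the bracket $(p,q)\mapsto[q,p]$): $q_0^-=x_0$, $q_n^-=[x_{-nm},f^{-m}(q^-_{n-1})]$ for $n\ge 1$, and $\mathrm{Sh}_f^-(x)=\lim_{n\to\infty}f^{nm}(q_n^-)$. The limits exist, and the induced map is $\mathrm{Sh}_f(x)=[\mathrm{Sh}_f^-(x),\mathrm{Sh}_f^+(x)]$. *)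

theory Defs
  imports "HOL-Analysis.Analysis"
begin

section \<open>Smooth structure of the sphere\<close>

text \<open>The sphere of dimension \<open>k\<close> is the unit sphere of a Euclidean space of dimension \<open>k + 1\<close>.\<close>

abbreviation usphere :: "'a::euclidean_space set" where
  "usphere \<equiv> sphere 0 1"

definition tangent_space :: "'a::euclidean_space \<Rightarrow> 'a set" where
  "tangent_space p = {v. p \<bullet> v = 0}"

primrec Ck_on :: "nat \<Rightarrow> 'a::real_normed_vector set \<Rightarrow> ('a \<Rightarrow> 'b::real_normed_vector) \<Rightarrow> bool" where
  "Ck_on 0 A f \<longleftrightarrow> continuous_on A f"
| "Ck_on (Suc n) A f \<longleftrightarrow>
     (\<forall>x\<in>A. f differentiable (at x)) \<and>
     (\<forall>v. Ck_on n A (\<lambda>x. frechet_derivative f (at x) v))"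

definition smooth_on :: "'a::real_normed_vector set \<Rightarrow> ('a \<Rightarrow> 'b::real_normed_vector) \<Rightarrow> bool" where
  "smooth_on A f \<longleftrightarrow> (\<forall>n. Ck_on n A f)"

text \<open>
  Since \<open>sgn x = x /\<^sub>R norm x\<close> is a smooth retraction of the punctured space onto the sphere, a map
  on the sphere is smooth iff its radial extension \<open>f \<circ> sgn\<close> is; and the derivative of
  \<open>sgn\<close> at a point \<open>p\<close> of the sphere is the orthogonal projection onto the tangent
  space, so \<open>tangent_map f p\<close> is the differential of \<open>f\<close> on tangent vectors.
\<close>

definition smooth_on_sphere :: "('a::euclidean_space \<Rightarrow> 'b::real_normed_vector) \<Rightarrow> bool" where
  "smooth_on_sphere f \<longleftrightarrow> smooth_on (- {0}) (f \<circ> sgn)"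

definition tangent_map :: "('a::euclidean_space \<Rightarrow> 'a) \<Rightarrow> 'a \<Rightarrow> 'a \<Rightarrow> 'a" where
  "tangent_map f p v = frechet_derivative (f \<circ> sgn) (at p) v"

definition sphere_diffeo :: "('a::euclidean_space \<Rightarrow> 'a) \<Rightarrow> bool" where
  "sphere_diffeo f \<longleftrightarrow>
     bij_betw f usphere usphere \<and> smooth_on_sphere f \<and> smooth_on_sphere (inv_into usphere f)"

text \<open>
  A fixed point is hyperbolic if the differential there has no complex eigenvalue \<open>z\<close> of modulus
  one. The eigenvector \<open>v + \<i> w\<close> of the complexified differential is given by its real and
  imaginary parts.
\<close>

definition hyperbolic_fixed_point :: "('a::euclidean_space \<Rightarrow> 'a) \<Rightarrow> 'a \<Rightarrow> bool" where
  "hyperbolic_fixed_point f p \<longleftrightarrow>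
     p \<in> usphere \<and> f p = p \<and>
     \<not> (\<exists>z::complex. \<exists>v\<in>tangent_space p. \<exists>w\<in>tangent_space p.
          cmod z = 1 \<and> (v, w) \<noteq> (0, 0) \<and>
          tangent_map f p v = Re z *\<^sub>R v - Im z *\<^sub>R w \<and>
          tangent_map f p w = Im z *\<^sub>R v + Re z *\<^sub>R w)"

definition north_south :: "('a::euclidean_space \<Rightarrow> 'a) \<Rightarrow> 'a \<Rightarrow> 'a \<Rightarrow> bool" where
  "north_south f N S \<longleftrightarrow>
     sphere_diffeo f \<and> N \<noteq> S \<and> hyperbolic_fixed_point f N \<and> hyperbolic_fixed_point f S \<and>
     (\<forall>p\<in>usphere - {N, S}.
        (\<lambda>n. (f ^^ n) p) \<longlonglongrightarrow> S \<and> (\<lambda>n. (inv_into usphere f ^^ n) p) \<longlonglongrightarrow> N)"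

section \<open>Riemannian metrics on the sphere\<close>

text \<open>
  A metric is a function \<open>g p v w\<close> of a point \<open>p\<close> of the sphere and two tangent vectors there.
  \<open>metric_ext g\<close> extends it to all nonzero points and all vectors, by radial and orthogonal
  projection.
\<close>

definition metric_ext :: "('a::euclidean_space \<Rightarrow> 'a \<Rightarrow> 'a \<Rightarrow> real) \<Rightarrow> 'a \<Rightarrow> 'a \<Rightarrow> 'a \<Rightarrow> real" where
  "metric_ext g x v w =
     g (sgn x) (v - (sgn x \<bullet> v) *\<^sub>R sgn x) (w - (sgn x \<bullet> w) *\<^sub>R sgn x)"

definition riemannian_metric :: "('a::euclidean_space \<Rightarrow> 'a \<Rightarrow> 'a \<Rightarrow> real) \<Rightarrow> bool" where
  "riemannian_metric g \<longleftrightarrow>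
     (\<forall>p\<in>usphere. \<forall>v\<in>tangent_space p. \<forall>w\<in>tangent_space p.
        g p v w = g p w v \<and> (v \<noteq> 0 \<longrightarrow> g p v v > 0) \<and>
        (\<forall>u\<in>tangent_space p. \<forall>a b. g p (a *\<^sub>R u + b *\<^sub>R v) w = a * g p u w + b * g p v w)) \<and>
     (\<forall>v w. smooth_on (- {0}) (\<lambda>x. metric_ext g x v w))"

definition riem_norm :: "('a::euclidean_space \<Rightarrow> 'a \<Rightarrow> 'a \<Rightarrow> real) \<Rightarrow> 'a \<Rightarrow> 'a \<Rightarrow> real" where
  "riem_norm g p v = sqrt (g p v v)"

text \<open>
  \<open>valid_path\<close> does not bound the derivative near a breakpoint, so a path may have infinite length;
  such paths are excluded by \<open>has_integral\<close> (\<open>integral\<close> would give them length zero).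
\<close>

definition riem_dist :: "('a::euclidean_space \<Rightarrow> 'a \<Rightarrow> 'a \<Rightarrow> real) \<Rightarrow> 'a \<Rightarrow> 'a \<Rightarrow> real" where
  "riem_dist g p q =
     Inf {l. \<exists>c. valid_path c \<and> path_image c \<subseteq> usphere \<and> pathstart c = p \<and> pathfinish c = q \<and>
               ((\<lambda>t. riem_norm g (c t) (vector_derivative c (at t))) has_integral l) {0..1}}"

text \<open>
  The geodesic equation says that the covariant acceleration along \<open>c\<close> vanishes. By the Koszul
  formula its inner product with a vector \<open>w\<close> tangent at \<open>c t\<close> is
  \<open>d/dt G(c')(c', w) - 1/2 (D\<^sub>w G)(c', c')\<close>, where \<open>G\<close> is any smooth extension of the metric to a
  neighbourhood of the sphere and \<open>w\<close> is kept constant in the ambient space; here \<open>G\<close> is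
  \<open>metric_ext g\<close>. The sphere being compact, geodesics are defined for all times.
\<close>

definition geodesic :: "('a::euclidean_space \<Rightarrow> 'a \<Rightarrow> 'a \<Rightarrow> real) \<Rightarrow> (real \<Rightarrow> 'a) \<Rightarrow> bool" where
  "geodesic g c \<longleftrightarrow>
     range c \<subseteq> usphere \<and>
     (\<exists>c'. (\<forall>t. (c has_vector_derivative c' t) (at t) \<and> c' differentiable (at t)) \<and>
           (\<forall>t. \<forall>w\<in>tangent_space (c t).
              ((\<lambda>s. metric_ext g (c s) (c' s) w) has_real_derivative
                 frechet_derivative (\<lambda>x. metric_ext g x (c' t) (c' t)) (at (c t)) w / 2) (at t)))"

definition riem_exp :: "('a::euclidean_space \<Rightarrow> 'a \<Rightarrow> 'a \<Rightarrow> real) \<Rightarrow> 'a \<Rightarrow> 'a \<Rightarrow> 'a" where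
  "riem_exp g p v =
     (THE q. \<exists>c. geodesic g c \<and> c 0 = p \<and> (c has_vector_derivative v) (at 0) \<and> c 1 = q)"

definition tangent_disc :: "('a::euclidean_space \<Rightarrow> 'a \<Rightarrow> 'a \<Rightarrow> real) \<Rightarrow> real \<Rightarrow> 'a \<Rightarrow> 'a set" where
  "tangent_disc g \<rho> p = {v \<in> tangent_space p. riem_norm g p v \<le> \<rho>}"

definition riem_log :: "('a::euclidean_space \<Rightarrow> 'a \<Rightarrow> 'a \<Rightarrow> real) \<Rightarrow> real \<Rightarrow> 'a \<Rightarrow> 'a \<Rightarrow> 'a" where
  "riem_log g \<rho> p = inv_into (tangent_disc g \<rho> p) (riem_exp g p)"

definition riem_ball :: "('a::euclidean_space \<Rightarrow> 'a \<Rightarrow> 'a \<Rightarrow> real) \<Rightarrow> 'a \<Rightarrow> real \<Rightarrow> 'a set" where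
  "riem_ball g p r = {q \<in> usphere. riem_dist g q p < r}"

definition geodesic_segment ::
    "('a::euclidean_space \<Rightarrow> 'a \<Rightarrow> 'a \<Rightarrow> real) \<Rightarrow> real \<Rightarrow> 'a \<Rightarrow> 'a \<Rightarrow> 'a set" where
  "geodesic_segment g \<rho> p q = (\<lambda>t. riem_exp g p (t *\<^sub>R riem_log g \<rho> p q)) ` {0..1}"

definition bracket ::
    "('a::euclidean_space \<Rightarrow> 'a \<Rightarrow> 'a \<Rightarrow> real) \<Rightarrow> ('a \<Rightarrow> real) \<Rightarrow> real \<Rightarrow> 'a \<Rightarrow> 'a \<Rightarrow> 'a" where
  "bracket g \<phi> \<rho> p q = riem_exp g p (\<phi> p *\<^sub>R riem_log g \<rho> p q)"

section \<open>Pseudo-orbits, brackets and shadowing maps\<close>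

text \<open>Here \<open>M\<close> is a space with distance \<open>d\<close>; both are explicit parameters.\<close>

definition zpow :: "'b set \<Rightarrow> ('b \<Rightarrow> 'b) \<Rightarrow> int \<Rightarrow> 'b \<Rightarrow> 'b" where
  "zpow A f i = (if 0 \<le> i then f ^^ nat i else inv_into A f ^^ nat (- i))"

definition shift :: "(int \<Rightarrow> 'b) \<Rightarrow> int \<Rightarrow> 'b" where
  "shift x = (\<lambda>i. x (i + 1))"

definition orb :: "'b set \<Rightarrow> ('b \<Rightarrow> 'b) \<Rightarrow> 'b \<Rightarrow> int \<Rightarrow> 'b" where
  "orb M f p = (\<lambda>i. zpow M f i p)"

definition seq_dist :: "('b \<Rightarrow> 'b \<Rightarrow> real) \<Rightarrow> real \<Rightarrow> (int \<Rightarrow> 'b) \<Rightarrow> (int \<Rightarrow> 'b) \<Rightarrow> real" where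
  "seq_dist d \<mu> x y = (\<Sum>\<^sub>\<infinity>i\<in>UNIV. \<mu> ^ nat \<bar>i\<bar> * d (x i) (y i))"

definition pseudo_orbits ::
    "'b set \<Rightarrow> ('b \<Rightarrow> 'b \<Rightarrow> real) \<Rightarrow> ('b \<Rightarrow> 'b) \<Rightarrow> real \<Rightarrow> (int \<Rightarrow> 'b) set" where
  "pseudo_orbits M d f \<delta> = {x. (\<forall>i. x i \<in> M) \<and> (\<forall>i. d (x (i + 1)) (f (x i)) \<le> \<delta>)}"

definition close_pairs :: "'b set \<Rightarrow> ('b \<Rightarrow> 'b \<Rightarrow> real) \<Rightarrow> real \<Rightarrow> ('b \<times> 'b) set" where
  "close_pairs M d \<gamma> = {(p, q). p \<in> M \<and> q \<in> M \<and> d p q \<le> \<gamma>}"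

definition self_tuning ::
    "'b set \<Rightarrow> ('b \<Rightarrow> 'b \<Rightarrow> real) \<Rightarrow> real \<Rightarrow> ('b \<Rightarrow> 'b) \<Rightarrow> real \<Rightarrow> ((int \<Rightarrow> 'b) \<Rightarrow> 'b) \<Rightarrow> bool" where
  "self_tuning M d \<mu> f \<delta> Sh \<longleftrightarrow>
     (\<forall>\<epsilon>>0. \<exists>\<eta>>0. \<forall>x\<in>pseudo_orbits M d f \<delta>. \<forall>i::int.
        seq_dist d \<mu> (zpow UNIV shift i x) (orb M f (x i)) < \<eta> \<longrightarrow>
        d (zpow M f i (Sh x)) (Sh (zpow UNIV shift i x)) \<le> \<epsilon>)"

definition shift_invariant ::
    "'b set \<Rightarrow> ('b \<Rightarrow> 'b \<Rightarrow> real) \<Rightarrow> ('b \<Rightarrow> 'b) \<Rightarrow> real \<Rightarrow> ((int \<Rightarrow> 'b) \<Rightarrow> 'b) \<Rightarrow> bool" where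
  "shift_invariant M d f \<delta> Sh \<longleftrightarrow>
     (\<exists>\<delta>'. 0 < \<delta>' \<and> \<delta>' \<le> \<delta> \<and> (\<forall>x\<in>pseudo_orbits M d f \<delta>'. Sh (shift x) = f (Sh x)))"

definition hyperbolic_bracket ::
    "'b set \<Rightarrow> ('b \<Rightarrow> 'b \<Rightarrow> real) \<Rightarrow> ('b \<Rightarrow> 'b) \<Rightarrow> real \<Rightarrow> real \<Rightarrow> real \<Rightarrow> ('b \<Rightarrow> 'b \<Rightarrow> 'b) \<Rightarrow> bool" where
  "hyperbolic_bracket M d f \<gamma> c lam br \<longleftrightarrow>
     (\<forall>(p, q)\<in>close_pairs M d \<gamma>.
        br p q \<in> M \<and>
        (\<forall>n. d ((f ^^ n) (br p q)) ((f ^^ n) q) \<le> c * lam ^ n * d p q \<and>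
             d ((inv_into M f ^^ n) (br p q)) ((inv_into M f ^^ n) p) \<le> c * lam ^ n * d p q))"

text \<open>
  One-sided construction, with \<open>F'\<close> the inverse of \<open>F\<close>. The backward map is the same construction
  for the inverse of \<open>f\<close>, the reversed sequence and the bracket with swapped arguments.
\<close>

primrec shadow_seq ::
    "('b \<Rightarrow> 'b) \<Rightarrow> nat \<Rightarrow> ('b \<Rightarrow> 'b \<Rightarrow> 'b) \<Rightarrow> (int \<Rightarrow> 'b) \<Rightarrow> nat \<Rightarrow> 'b" where
  "shadow_seq F m br x 0 = x 0"
| "shadow_seq F m br x (Suc n) = br ((F ^^ m) (shadow_seq F m br x n)) (x (int (Suc n * m)))"

definition shadow_lim ::
    "('b::t2_space \<Rightarrow> 'b) \<Rightarrow> ('b \<Rightarrow> 'b) \<Rightarrow> nat \<Rightarrow> ('b \<Rightarrow> 'b \<Rightarrow> 'b) \<Rightarrow> (int \<Rightarrow> 'b) \<Rightarrow> 'b" where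
  "shadow_lim F F' m br x = lim (\<lambda>n. (F' ^^ (n * m)) (shadow_seq F m br x n))"

definition shadow_plus ::
    "'b::t2_space set \<Rightarrow> ('b \<Rightarrow> 'b) \<Rightarrow> nat \<Rightarrow> ('b \<Rightarrow> 'b \<Rightarrow> 'b) \<Rightarrow> (int \<Rightarrow> 'b) \<Rightarrow> 'b" where
  "shadow_plus M f m br x = shadow_lim f (inv_into M f) m br x"

definition shadow_minus ::
    "'b::t2_space set \<Rightarrow> ('b \<Rightarrow> 'b) \<Rightarrow> nat \<Rightarrow> ('b \<Rightarrow> 'b \<Rightarrow> 'b) \<Rightarrow> (int \<Rightarrow> 'b) \<Rightarrow> 'b" where
  "shadow_minus M f m br x =
     shadow_lim (inv_into M f) f m (\<lambda>p q. br q p) (\<lambda>i. x (- i))"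

definition shadow_map ::
    "'b::t2_space set \<Rightarrow> ('b \<Rightarrow> 'b) \<Rightarrow> nat \<Rightarrow> ('b \<Rightarrow> 'b \<Rightarrow> 'b) \<Rightarrow> (int \<Rightarrow> 'b) \<Rightarrow> 'b" where
  "shadow_map M f m br x = br (shadow_minus M f m br x) (shadow_plus M f m br x)"

text \<open>All brackets occurring in the definition of \<open>shadow_map\<close> on the \<open>\<delta>\<close>-pseudo-orbits
  are taken at pairs at distance at most \<open>\<gamma>\<close>.\<close>

definition shadow_brackets_defined ::
    "'b::t2_space set \<Rightarrow> ('b \<Rightarrow> 'b \<Rightarrow> real) \<Rightarrow> ('b \<Rightarrow> 'b) \<Rightarrow> real \<Rightarrow> real \<Rightarrow> nat \<Rightarrow>
     ('b \<Rightarrow> 'b \<Rightarrow> 'b) \<Rightarrow> bool" where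
  "shadow_brackets_defined M d f \<delta> \<gamma> m br \<longleftrightarrow>
     (\<forall>x\<in>pseudo_orbits M d f \<delta>.
        (\<forall>n. ((f ^^ m) (shadow_seq f m br x n), x (int (Suc n * m))) \<in> close_pairs M d \<gamma>) \<and>
        (\<forall>n. (x (- int (Suc n * m)),
              (inv_into M f ^^ m)
                (shadow_seq (inv_into M f) m (\<lambda>p q. br q p) (\<lambda>i. x (- i)) n)) \<in> close_pairs M d \<gamma>) \<and>
        (shadow_minus M f m br x, shadow_plus M f m br x) \<in> close_pairs M d \<gamma>)"

end

theory Submission
  imports Defs
begin

text \<open>
  Self-tuning rests on the hyperbolicity of the bracket alone. Let \<open>e\<^sub>n\<close> be the distance between
  \<open>f\<^sup>m(q\<^sub>n)\<close> and \<open>x\<close> at time \<open>(n + 1) m\<close>, the two arguments of a bracket in the construction of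
  \<open>Sh\<^sup>+(x)\<close>. The bracket \<open>q\<^sub>n\<^sub>+\<^sub>1\<close> of these points is forward asymptotic to the second one, so that
  after \<open>m\<close> more steps their distance is at most \<open>e\<^sub>n / 2\<close>; hence \<open>e\<^sub>n\<^sub>+\<^sub>1 \<le> e\<^sub>n / 2 + t\<^sub>n\<^sub>+\<^sub>1\<close>, where
  \<open>t\<^sub>n\<close> measures how far \<open>x\<close> is from an orbit on the \<open>n\<close>-th block of \<open>m\<close> times. An earlier
  error is thus forgotten exponentially fast. A later one has an exponentially small effect as well, because the
  bracket is backward asymptotic to its first argument: replacing \<open>q\<^sub>n\<^sub>+\<^sub>l\<close> by \<open>q\<^sub>n\<^sub>+\<^sub>l\<^sub>+\<^sub>1\<close> moves
  the approximation of \<open>f\<^sup>n\<^sup>m(Sh\<^sup>+(x))\<close> that it gives by at most \<open>e\<^sub>n\<^sub>+\<^sub>l / 2\<^sup>l\<^sup>+\<^sup>1\<close>. So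
  \<open>f\<^sup>i(Sh\<^sup>+(x))\<close> is close to \<open>x\<^sub>i\<close> as soon as \<open>x\<close> is nearly an orbit on a long window around \<open>i\<close>
  (\<open>shadow_lim_tracks\<close>). The final bracket with \<open>Sh\<^sup>-(x)\<close> does no harm: for large \<open>i\<close> its effect has
  been contracted away, and for small \<open>i\<close> the window contains the time \<open>0\<close>, where \<open>Sh\<^sup>-(x)\<close> and
  \<open>Sh\<^sup>+(x)\<close> are both close to \<open>x\<^sub>0\<close> (\<open>bracket_shadow_tracks\<close>); negative \<open>i\<close> are covered by reversing
  time. If \<open>\<sigma>\<^sup>i(x)\<close> is close to the orbit of \<open>x\<^sub>i\<close>, then \<open>x\<close> is nearly an orbit around \<open>i\<close>, and
  \<open>f\<^sup>i(Sh(x))\<close> and \<open>Sh(\<sigma>\<^sup>i(x))\<close> are both close to \<open>x\<^sub>i\<close> (\<open>self_tuning_shadow_map\<close>).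

  Shift-invariance fails because the construction looks at \<open>x\<close> only at multiples of \<open>m\<close>, while the
  bracket is the second argument near \<open>N\<close> and the first argument near \<open>S\<close>. Let \<open>p\<close> be the first
  point of an orbit outside the ball around \<open>N\<close>. The constants force \<open>2 u < m\<close>, and an orbit needs
  at most \<open>2 u\<close> steps from \<open>p\<close> to the ball around \<open>S\<close>. Let \<open>x\<close> follow the orbit of \<open>p\<close> at negative
  times and that of a nearby point \<open>q\<close> from time \<open>0\<close> on. For \<open>x\<close> the brackets that see both orbits are
  taken at the times \<open>-m\<close>, \<open>-2m\<close> and so on, near \<open>N\<close>, and all of them choose \<open>q\<close>: the result is
  \<open>q\<close>. For \<open>\<sigma>\<^sup>-\<^sup>1(x)\<close> they are taken at the times \<open>m - 1\<close>, \<open>2m - 1\<close> and so on of \<open>x\<close>, near \<open>S\<close>, and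
  choose \<open>p\<close>: the result is \<open>f\<^sup>-\<^sup>1(p)\<close> (\<open>shadow_map_of_jump\<close>). Equivariance would give \<open>q = p\<close>.

  Both arguments need that the Riemannian distance is a metric with the Euclidean topology
  (\<open>riem_dist_metric\<close>): by compactness of the unit tangent bundle the two kinds of length of a curve
  are comparable, and arcs of great circles provide short curves between any two points.
\<close>

section \<open>Tracking by the one-sided construction\<close>

lemma funpow_inverse:
  assumes "f ` A \<subseteq> A" "\<And>p. p \<in> A \<Longrightarrow> f' (f p) = p" "p \<in> A"
  shows "(f' ^^ n) ((f ^^ n) p) = p"
proof (induction n)
  case (Suc n)
  have "(f ^^ n) p \<in> A" using assms by (induction n) auto
  then have "(f' ^^ n) (f' (f ((f ^^ n) p))) = p" using Suc assms(2) by simp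
  then show ?case by (simp add: funpow_swap1)
qed simp

locale inverse_pair =
  fixes M :: "'b::t2_space set" and F F' :: "'b \<Rightarrow> 'b"
  assumes F_in: "\<And>p. p \<in> M \<Longrightarrow> F p \<in> M" and F'_in: "\<And>p. p \<in> M \<Longrightarrow> F' p \<in> M"
    and F'_F: "\<And>p. p \<in> M \<Longrightarrow> F' (F p) = p" and F_F': "\<And>p. p \<in> M \<Longrightarrow> F (F' p) = p"
begin

lemma Fn_in: "p \<in> M \<Longrightarrow> (F ^^ n) p \<in> M" and F'n_in: "p \<in> M \<Longrightarrow> (F' ^^ n) p \<in> M"
  by (induction n) (auto simp: F_in F'_in)

lemma F'n_Fn: "p \<in> M \<Longrightarrow> (F' ^^ n) ((F ^^ n) p) = p" and Fn_F'n: "p \<in> M \<Longrightarrow> (F ^^ n) ((F' ^^ n) p) = p"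
  using F_in F'_in F_F' F'_F by (auto intro!: funpow_inverse[of _ M])

end

lemma inverse_pair_inv_into:
  assumes "bij_betw f M M"
  shows "inverse_pair M f (inv_into M f)"
  using assms bij_betw_inv_into[OF assms]
  by unfold_locales (auto simp: bij_betw_inv_into_left bij_betw_inv_into_right bij_betw_apply)

text \<open>
  The construction started at \<open>x 0\<close> stays within the domain of the bracket. The predicate depends on
  one map only, so that it can be used for a system and for its time reversal.
\<close>

definition admissible ::
    "'b set \<Rightarrow> ('b \<Rightarrow> 'b \<Rightarrow> real) \<Rightarrow> ('b \<Rightarrow> 'b) \<Rightarrow> nat \<Rightarrow> ('b \<Rightarrow> 'b \<Rightarrow> 'b) \<Rightarrow> real \<Rightarrow> (int \<Rightarrow> 'b) \<Rightarrow> bool" where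
  "admissible M d F m b \<gamma> x \<longleftrightarrow> (\<forall>i. x i \<in> M) \<and>
     (\<forall>n. (F ^^ m) (shadow_seq F m b x n) \<in> M \<and>
          d ((F ^^ m) (shadow_seq F m b x n)) (x (int (Suc n * m))) \<le> \<gamma>)"

text \<open>
  Completeness speaks of two notions of convergence: \<open>shadow_lim\<close> is a limit in the topology of the
  type, whereas all estimates are in terms of \<open>d\<close>. The distance is constrained on \<open>M\<close> only, because
  a Riemannian distance has no meaning off the manifold.
\<close>

locale hyperbolic_system =
  inverse_pair M F F' for M :: "'b::t2_space set" and F F' +
  fixes d :: "'b \<Rightarrow> 'b \<Rightarrow> real" and b :: "'b \<Rightarrow> 'b \<Rightarrow> 'b"
    and L lam c \<gamma> :: real and m :: nat
  assumes d_nonneg: "\<And>p q. p \<in> M \<Longrightarrow> q \<in> M \<Longrightarrow> 0 \<le> d p q"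
    and d_commute: "\<And>p q. p \<in> M \<Longrightarrow> q \<in> M \<Longrightarrow> d p q = d q p"
    and d_triangle: "\<And>p q z. p \<in> M \<Longrightarrow> q \<in> M \<Longrightarrow> z \<in> M \<Longrightarrow> d p z \<le> d p q + d q z"
    and d_refl: "\<And>p. p \<in> M \<Longrightarrow> d p p = 0"
    and d_complete: "\<And>X. (\<And>n. X n \<in> M) \<Longrightarrow> (\<And>e. e > 0 \<Longrightarrow> \<exists>N. \<forall>n\<ge>N. \<forall>k. d (X (n + k)) (X n) < e) \<Longrightarrow>
           \<exists>l\<in>M. X \<longlonglongrightarrow> l \<and> (\<lambda>n. d (X n) l) \<longlonglongrightarrow> 0"
    and F_lipschitz: "\<And>p q. p \<in> M \<Longrightarrow> q \<in> M \<Longrightarrow> d (F p) (F q) \<le> L * d p q"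
    and F'_lipschitz: "\<And>p q. p \<in> M \<Longrightarrow> q \<in> M \<Longrightarrow> d (F' p) (F' q) \<le> L * d p q"
    and L: "1 \<le> L" and lam: "0 < lam" "lam < 1" and c: "1 \<le> c"
    and m: "1 \<le> m" "c * lam ^ m \<le> 1 / 2" and \<gamma>: "0 < \<gamma>"
    and b_in: "\<And>p q. p \<in> M \<Longrightarrow> q \<in> M \<Longrightarrow> d p q \<le> \<gamma> \<Longrightarrow> b p q \<in> M"
    and b_forward: "\<And>p q n. p \<in> M \<Longrightarrow> q \<in> M \<Longrightarrow> d p q \<le> \<gamma> \<Longrightarrow>
           d ((F ^^ n) (b p q)) ((F ^^ n) q) \<le> c * lam ^ n * d p q"
    and b_backward: "\<And>p q n. p \<in> M \<Longrightarrow> q \<in> M \<Longrightarrow> d p q \<le> \<gamma> \<Longrightarrow>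
           d ((F' ^^ n) (b p q)) ((F' ^^ n) p) \<le> c * lam ^ n * d p q"
begin

text \<open>
  Exchanging the two maps and the two arguments of the bracket exchanges its forward and backward
  contraction. Each statement about the future thereby has a version about the past.
\<close>

lemma reversed: "hyperbolic_system M F' F d (\<lambda>p q. b q p) L lam c \<gamma> m"
proof unfold_locales
  show "d ((F' ^^ n) (b q p)) ((F' ^^ n) q) \<le> c * lam ^ n * d p q" 
    "d ((F ^^ n) (b q p)) ((F ^^ n) p) \<le> c * lam ^ n * d p q"
    "b q p \<in> M"
    if "p \<in> M" "q \<in> M" "d p q \<le> \<gamma>" for p q n
    using b_forward[of q p n] b_backward[of q p n] b_in[of q p] that d_commute[of p q] by auto
qed (use d_nonneg d_commute d_triangle d_refl d_complete F_in F'_in F_F' F'_F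
    F_lipschitz F'_lipschitz L lam c m \<gamma> in auto)

lemma d_triangle_le:
  "d p q \<le> s \<Longrightarrow> d q z \<le> t \<Longrightarrow> p \<in> M \<Longrightarrow> q \<in> M \<Longrightarrow> z \<in> M \<Longrightarrow> d p z \<le> s + t"
  using d_triangle[of p q z] by linarith

lemma Fn_lipschitz: "p \<in> M \<Longrightarrow> q \<in> M \<Longrightarrow> d ((F ^^ n) p) ((F ^^ n) q) \<le> L ^ n * d p q"
proof (induction n)
  case (Suc n)
  have "d ((F ^^ Suc n) p) ((F ^^ Suc n) q) \<le> L * d ((F ^^ n) p) ((F ^^ n) q)"
    using Suc.prems by (simp add: F_lipschitz Fn_in)
  also have "\<dots> \<le> L * (L ^ n * d p q)"
    using Suc L by (intro mult_left_mono) auto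
  finally show ?case by simp
qed simp

lemma accumulated_error:
  assumes "\<And>j. y j \<in> M" and "\<And>j. a \<le> j \<Longrightarrow> j < a + k \<Longrightarrow> d (F (y j)) (y (Suc j)) \<le> \<theta>" and "0 \<le> \<theta>"
  shows "d ((F ^^ k) (y a)) (y (a + k)) \<le> k * L ^ k * \<theta>"
  using assms(2)
proof (induction k)
  case 0
  then show ?case using assms(1) d_refl by simp
next
  case (Suc k)
  have 1: "1 \<le> L ^ Suc k" using L by (intro one_le_power)
  have "d ((F ^^ Suc k) (y a)) (y (a + Suc k))
      \<le> d (F ((F ^^ k) (y a))) (F (y (a + k))) + d (F (y (a + k))) (y (Suc (a + k)))"
    using d_triangle F_in Fn_in assms(1) by simp
  also have "\<dots> \<le> L * (k * L ^ k * \<theta>) + \<theta>"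
  proof (intro add_mono)
    have "d (F ((F ^^ k) (y a))) (F (y (a + k))) \<le> L * d ((F ^^ k) (y a)) (y (a + k))"
      using F_lipschitz Fn_in assms(1) by blast
    also have "\<dots> \<le> L * (k * L ^ k * \<theta>)"
      using Suc L by (intro mult_left_mono) auto
    finally show "d (F ((F ^^ k) (y a))) (F (y (a + k))) \<le> L * (k * L ^ k * \<theta>)" .
  qed (use Suc.prems in simp)
  also have "\<dots> \<le> k * L ^ Suc k * \<theta> + L ^ Suc k * \<theta>"
    using mult_right_mono[OF 1 assms(3)] by simp
  finally show ?case by (simp add: algebra_simps)
qed

lemma geometric_chain:
  assumes "\<And>k. v k \<in> M" and "\<And>k. a \<le> k \<Longrightarrow> k < a + l \<Longrightarrow> d (v (Suc k)) (v k) \<le> C * (1/2) ^ Suc k"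
    and "0 \<le> C"
  shows "d (v (a + l)) (v a) \<le> C * (1/2) ^ a"
proof -
  have "d (v (a + l)) (v a) \<le> C * ((1/2) ^ a - (1/2) ^ (a + l))"
    using assms(2)
  proof (induction l)
    case 0
    then show ?case using assms(1) d_refl by simp
  next
    case (Suc l)
    have "d (v (a + Suc l)) (v a) \<le> d (v (Suc (a + l))) (v (a + l)) + d (v (a + l)) (v a)"
      using d_triangle assms(1) by simp
    also have "\<dots> \<le> C * (1/2) ^ Suc (a + l) + C * ((1/2) ^ a - (1/2) ^ (a + l))"
      using Suc by (intro add_mono) auto
    finally show ?case by (simp add: algebra_simps)
  qed
  also have "\<dots> \<le> C * (1/2) ^ a"
    using assms(3) by (intro mult_left_mono) auto
  finally show ?thesis .
qed

text \<open>
  A single factor \<open>c\<close> suffices for all the blocks of \<open>m\<close> steps together: the first block absorbs it, and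
  \<open>lam ^ m \<le> 1 / 2\<close> holds for the others since \<open>1 \<le> c\<close>.
\<close>

lemma lam_power: "c * lam ^ (Suc l * m) \<le> (1/2) ^ Suc l"
proof (induction l)
  case 0
  then show ?case using m by simp
next
  case (Suc l)
  have "lam ^ m \<le> c * lam ^ m" using c lam by simp
  then have "lam ^ m \<le> 1/2" using m by simp
  have "c * lam ^ (Suc (Suc l) * m) = lam ^ m * (c * lam ^ (Suc l * m))"
    by (simp add: power_add)
  also have "\<dots> \<le> (1/2) * (1/2) ^ Suc l"
    using Suc \<open>lam ^ m \<le> 1/2\<close> lam c by (intro mult_mono) auto
  finally show ?case by simp
qed

lemma limit_dist_le:
  assumes "\<And>n. X n \<in> M" "l \<in> M" "z \<in> M" "(\<lambda>n. d (X n) l) \<longlonglongrightarrow> 0" "\<And>n. d (X n) z \<le> C"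
  shows "d l z \<le> C"
proof -
  have "(\<lambda>n. d (X n) l + C) \<longlonglongrightarrow> 0 + C"
    by (intro tendsto_add assms tendsto_const)
  then have "(\<lambda>n. d (X n) l + C) \<longlonglongrightarrow> C" by simp
  moreover have "d l z \<le> d (X n) l + C" for n
    using d_triangle[of l "X n" z] d_commute[of l "X n"] assms(1)[of n] assms(2,3) assms(5)[of n] by linarith
  ultimately show ?thesis
    by (intro LIMSEQ_le_const[of "\<lambda>n. d (X n) l + C"]) auto
qed

text \<open>
  In what follows \<open>q\<close> is the sequence of the construction, and the gap \<open>e n\<close> is the distance between
  the two arguments of the bracket that produces \<open>q (Suc n)\<close>.
\<close>

context
  fixes x :: "int \<Rightarrow> 'b" and q e
  assumes adm: "admissible M d F m b \<gamma> x"
  defines "q \<equiv> shadow_seq F m b x"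
    and "e \<equiv> \<lambda>n. d ((F ^^ m) (shadow_seq F m b x n)) (x (int (Suc n * m)))"
begin

lemma admissible_in: "x i \<in> M" using adm by (auto simp: admissible_def)

lemma gap_le: "e n \<le> \<gamma>" using adm by (auto simp: admissible_def e_def)

lemma gap_nonneg: "0 \<le> e n" using adm d_nonneg by (auto simp: admissible_def e_def)

lemma shadow_seq_in: "q n \<in> M"
proof (cases n)
  case 0
  then show ?thesis using admissible_in by (simp add: q_def)
next
  case (Suc n)
  then show ?thesis using adm b_in by (auto simp: admissible_def q_def)
qed

lemma shadow_seq_near: "d (q (Suc n)) (x (int (Suc n * m))) \<le> c * e n"
  using b_forward[of "(F ^^ m) (q n)" "x (int (Suc n * m))" 0] adm
  by (auto simp: admissible_def q_def e_def)

text \<open>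
  The bracket is backward asymptotic to its first argument \<open>F\<^sup>m(q n)\<close>, so pulling
  \<open>q (Suc n)\<close> back by \<open>m\<close> steps leads close to \<open>q n\<close>, and pulling both back further brings them
  together. This makes the approximations of the shadowing limit a Cauchy sequence.
\<close>

lemma shadow_seq_pullback:
  "d ((F' ^^ (Suc l * m)) (q (Suc (n + l)))) ((F' ^^ (l * m)) (q (n + l))) \<le> e (n + l) * (1/2) ^ Suc l"
proof -
  let ?k = "n + l"
  interpret rev: hyperbolic_system M F' F d "\<lambda>p q. b q p" L lam c \<gamma> m by (rule reversed)
  have "(F' ^^ (Suc l * m)) ((F ^^ m) (q ?k)) = (F' ^^ (l * m)) (q ?k)"
    using rev.Fn_F'n[OF shadow_seq_in, of m ?k] by (simp add: funpow_add add.commute[of m])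
  moreover have "d ((F' ^^ (Suc l * m)) (q (Suc ?k))) ((F' ^^ (Suc l * m)) ((F ^^ m) (q ?k)))
      \<le> c * lam ^ (Suc l * m) * e ?k"
    using b_backward[of "(F ^^ m) (q ?k)" "x (int (Suc ?k * m))" "Suc l * m"] adm
    unfolding admissible_def q_def e_def shadow_seq.simps by blast
  moreover have "c * lam ^ (Suc l * m) * e ?k \<le> (1/2) ^ Suc l * e ?k"
    using lam_power gap_nonneg by (intro mult_right_mono)
  ultimately show ?thesis by (simp add: mult.commute)
qed

lemma shadow_lim_properties:
  shows "shadow_lim F F' m b x \<in> M"
    and "(\<lambda>n. d ((F' ^^ (n * m)) (q n)) (shadow_lim F F' m b x)) \<longlonglongrightarrow> 0"
proof -
  let ?X = "\<lambda>n. (F' ^^ (n * m)) (q n)"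
  have X: "?X n \<in> M" for n using shadow_seq_in F'n_in by blast
  have "d (?X (Suc k)) (?X k) \<le> \<gamma> * (1/2) ^ Suc k" for k
  proof -
    have "d (?X (Suc k)) (?X k) \<le> e (0 + k) * (1/2) ^ Suc k"
      using shadow_seq_pullback[of k 0] by simp
    also have "\<dots> \<le> \<gamma> * (1/2) ^ Suc k"
      using gap_le by (intro mult_right_mono) auto
    finally show ?thesis .
  qed
  then have chain: "d (?X (n + k)) (?X n) \<le> \<gamma> * (1/2) ^ n" for n k
    using \<gamma> by (intro geometric_chain X) auto
  have "\<exists>N. \<forall>n\<ge>N. \<forall>k. d (?X (n + k)) (?X n) < \<epsilon>" if "\<epsilon> > 0" for \<epsilon>
  proof -
    obtain N where N: "(1/2) ^ N < \<epsilon> / \<gamma>"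
      using real_arch_pow_inv[of "\<epsilon>/\<gamma>" "1/2"] divide_pos_pos[of \<epsilon> \<gamma>] \<gamma> that \<open>\<epsilon> > 0\<close> by fastforce
    have "d (?X (n + k)) (?X n) < \<epsilon>" if "n \<ge> N" for n k
    proof -
      have "d (?X (n + k)) (?X n) \<le> \<gamma> * (1/2) ^ n" by (rule chain)
      also have "\<dots> \<le> \<gamma> * (1/2) ^ N"
        using \<gamma> that by (intro mult_left_mono power_decreasing) auto
      also have "\<dots> < \<epsilon>" using N \<gamma> by (simp add: field_simps)
      finally show ?thesis .
    qed
    then show ?thesis by blast
  qed
  from d_complete[of ?X, OF X this] obtain l where l: "l \<in> M" "?X \<longlonglongrightarrow> l" "(\<lambda>n. d (?X n) l) \<longlonglongrightarrow> 0"
    by blast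
  moreover have "shadow_lim F F' m b x = l"
    using limI[OF l(2)] by (simp add: shadow_lim_def q_def)
  ultimately show "shadow_lim F F' m b x \<in> M"
    "(\<lambda>n. d (?X n) (shadow_lim F F' m b x)) \<longlonglongrightarrow> 0" by auto
qed

text \<open>
  The gaps contribute to the distance with weights \<open>1/2\<close>, \<open>1/4\<close> and so on. The first \<open>N + 1\<close> of them
  are small by assumption, and the sum of the remaining weights is small, so that the trivial bound
  \<open>\<gamma>\<close> is enough for these.
\<close>

lemma shadow_lim_near:
  assumes E: "\<And>k. k \<le> N \<Longrightarrow> e (n + k) \<le> E" and "0 \<le> E"
  shows "d ((F ^^ (n * m)) (shadow_lim F F' m b x)) (q n) \<le> E + \<gamma> * (1/2) ^ N"
proof -
  let ?v = "\<lambda>l. (F' ^^ (l * m)) (q (n + l))"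
  let ?s = "shadow_lim F F' m b x"
  have v: "?v l \<in> M" for l using shadow_seq_in F'n_in by blast
  have step: "d (?v (Suc l)) (?v l) \<le> e (n + l) * (1/2) ^ Suc l" for l
    using shadow_seq_pullback[of l n] by simp
  have \<gamma>step: "d (?v (Suc l)) (?v l) \<le> \<gamma> * (1/2) ^ Suc l" for l
    by (rule order_trans[OF step mult_right_mono[OF gap_le]]) simp
  have Estep: "d (?v (Suc l)) (?v l) \<le> E * (1/2) ^ Suc l" if "l \<le> N" for l
    by (rule order_trans[OF step mult_right_mono[OF E[OF that]]]) simp
  have bound: "d (?v l) (?v 0) \<le> E + \<gamma> * (1/2) ^ N" for l
  proof (cases "l \<le> N")
    case True
    have "d (?v (0 + l)) (?v 0) \<le> E * (1/2) ^ 0"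
      using True by (intro geometric_chain v Estep assms) auto
    then show ?thesis using \<gamma> by (simp add: add_increasing2)
  next
    case False
    then obtain k where k: "l = N + k" by (metis le_iff_add nat_le_linear)
    have "d (?v (0 + N)) (?v 0) \<le> E * (1/2) ^ 0"
      by (intro geometric_chain v Estep assms) auto
    moreover have "d (?v (N + k)) (?v N) \<le> \<gamma> * (1/2) ^ N"
      using \<gamma> by (intro geometric_chain v \<gamma>step) auto
    moreover have "d (?v (N + k)) (?v 0) \<le> d (?v (N + k)) (?v N) + d (?v N) (?v 0)"
      using d_triangle v by blast
    ultimately show ?thesis unfolding k by simp
  qed
  let ?w = "\<lambda>l. (F' ^^ ((n + l) * m)) (q (n + l))"
  have w: "?w l \<in> M" for l using shadow_seq_in F'n_in by blast
  have Fw: "(F ^^ (n * m)) (?w l) = ?v l" for l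
    using Fn_F'n[OF v, of "n*m" l] by (simp add: add_mult_distrib funpow_add)
  have "(\<lambda>l. d (?w l) ?s) \<longlonglongrightarrow> 0"
    using LIMSEQ_ignore_initial_segment[OF shadow_lim_properties(2), of n] by (simp add: add.commute)
  then have lim: "(\<lambda>l. L ^ (n * m) * d (?w l) ?s) \<longlonglongrightarrow> 0"
    using tendsto_mult_right_zero by blast
  have "(\<lambda>l. d (?v l) ((F ^^ (n * m)) ?s)) \<longlonglongrightarrow> 0"
  proof (rule tendsto_sandwich[OF _ _ tendsto_const lim]; intro always_eventually allI)
    fix l
    show "0 \<le> d (?v l) ((F ^^ (n * m)) ?s)"
      by (intro d_nonneg v Fn_in shadow_lim_properties)
    show "d (?v l) ((F ^^ (n * m)) ?s) \<le> L ^ (n * m) * d (?w l) ?s"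
      using Fn_lipschitz[OF w[of l] shadow_lim_properties(1), of "n*m"] unfolding Fw .
  qed
  then have "d ((F ^^ (n * m)) ?s) (?v 0) \<le> E + \<gamma> * (1/2) ^ N"
    by (rule limit_dist_le[where X = ?v, rotated 3]) (use v[of 0] v bound Fn_in shadow_lim_properties(1) in auto)
  then show ?thesis by simp
qed

text \<open>
  Since the bracket is forward asymptotic to its second argument, \<open>m\<close> steps halve the previous gap
  before the error of the next block is added. Within a window of small block errors a gap is therefore bounded by twice
  these errors plus what is left of the gap at the start of the window, which is at most \<open>\<gamma>\<close>. A window
  that reaches back to time \<open>0\<close> has no such remainder, because the construction starts at \<open>x 0\<close>.
\<close>

lemma gap_decay:
  assumes T: "\<And>n. n0 \<le> n + N \<Longrightarrow> n \<le> n0 + N \<Longrightarrow>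
      d ((F ^^ m) (x (int (n * m)))) (x (int (Suc n * m))) \<le> T" and "0 \<le> T"
    and "n0 \<le> n + N" "n \<le> n0 + N"
  shows "e n \<le> \<gamma> * (1/2) ^ (n + N - n0) + 2 * T"
  using assms(3,4)
proof (induction n)
  case 0
  have "e 0 \<le> T" using T[of 0] 0 by (simp add: e_def)
  moreover have "0 \<le> \<gamma> * (1/2) ^ (0 + N - n0)" using \<gamma> by simp
  ultimately show ?case using \<open>0 \<le> T\<close> by linarith
next
  case (Suc n)
  show ?case
  proof (cases "n0 \<le> n + N")
    case True
    have IH: "e n \<le> \<gamma> * (1/2) ^ (n + N - n0) + 2 * T" using Suc True by simp
    have "d ((F ^^ m) (q (Suc n))) ((F ^^ m) (x (int (Suc n * m)))) \<le> c * lam ^ m * e n"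
      using b_forward[of "(F ^^ m) (q n)" "x (int (Suc n * m))" m] adm
      unfolding admissible_def q_def e_def shadow_seq.simps by blast
    also have "\<dots> \<le> 1/2 * e n"
      using m gap_nonneg by (intro mult_right_mono)
    finally have 1: "d ((F ^^ m) (q (Suc n))) ((F ^^ m) (x (int (Suc n * m)))) \<le> e n / 2" by simp
    have "e (Suc n) \<le> d ((F ^^ m) (q (Suc n))) ((F ^^ m) (x (int (Suc n * m))))
        + d ((F ^^ m) (x (int (Suc n * m)))) (x (int (Suc (Suc n) * m)))"
      unfolding e_def q_def[symmetric] by (intro d_triangle Fn_in shadow_seq_in admissible_in)
    also have "\<dots> \<le> e n / 2 + T"
      using T[of "Suc n"] Suc.prems by (intro add_mono 1) auto
    also have "\<dots> \<le> \<gamma> * ((1/2) ^ (n + N - n0) / 2) + 2 * T"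
      using IH by simp
    also have "(1/2::real) ^ (n + N - n0) / 2 = (1/2) ^ (Suc n + N - n0)"
      using True by (simp add: Suc_diff_le)
    finally show ?thesis .
  next
    case False
    then have "Suc n + N - n0 = 0" by simp
    then show ?thesis using gap_le[of "Suc n"] \<open>0 \<le> T\<close> by simp
  qed
qed

text \<open>
  The time \<open>i\<close> is compared with the last multiple \<open>n0 * m\<close> of \<open>m\<close> before it. There the shadowing
  limit is close to \<open>q n0\<close> by \<open>shadow_lim_near\<close>, and \<open>q n0\<close> is close to \<open>x\<close> since the gap before it
  is small. The remaining fewer than \<open>m\<close> steps cost a factor of at most \<open>L ^ m\<close>. The window leaves room for
  the \<open>N + 1\<close> blocks on either side that enter the estimate and for the block that contains \<open>i\<close>. The
  factors \<open>6 * c\<close> are generous.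
\<close>

lemma one_sided_estimate:
  assumes err: "\<And>j. i \<le> j + (N + 3) * m \<Longrightarrow> j \<le> i + (N + 3) * m \<Longrightarrow> d (F (x (int j))) (x (int (Suc j))) \<le> \<theta>"
    and \<theta>: "0 \<le> \<theta>"
  shows "d ((F ^^ i) (shadow_lim F F' m b x)) (x (int i))
     \<le> L ^ m * (6 * c * \<gamma> * (1/2) ^ N + 6 * c * (m * L ^ m * \<theta>))"
proof -
  let ?s = "shadow_lim F F' m b x"
  define T where "T = m * L ^ m * \<theta>"
  define n0 where "n0 = i div m"
  define a where "a = i mod m"
  have i: "i = n0 * m + a" and a: "a < m" using m by (auto simp: n0_def a_def)
  have T0: "0 \<le> T" using \<theta> L by (simp add: T_def)
  have T: "d ((F ^^ m) (x (int (n * m)))) (x (int (Suc n * m))) \<le> T"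
    if "n0 \<le> n + (N + 1)" "n \<le> n0 + (N + 1)" for n
  proof -
    have "n0 * m \<le> n * m + (N + 1) * m" "n * m \<le> n0 * m + (N + 1) * m"
      using mult_right_mono[OF that(1), of m] mult_right_mono[OF that(2), of m]
      by (simp_all add: add_mult_distrib)
    then have "d ((F ^^ m) (x (int (n * m)))) (x (int (n * m + m))) \<le> m * L ^ m * \<theta>"
      using accumulated_error[of "\<lambda>j. x (int j)" "n * m" m \<theta>] admissible_in \<theta> err i a
      by (simp add: add_mult_distrib)
    then show ?thesis by (simp add: T_def add.commute)
  qed
  \<comment> \<open>bounds the gaps from the one that produces \<open>q n0\<close> up to \<open>N\<close> blocks later\<close>
  define E where "E = 2 * \<gamma> * (1/2) ^ N + 2 * T"
  have E0: "0 \<le> E" using \<gamma> T0 by (simp add: E_def)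
  have e_small: "e n \<le> E" if "n0 \<le> Suc n" "n \<le> n0 + N" for n
  proof -
    have "e n \<le> \<gamma> * (1/2) ^ (n + (N + 1) - n0) + 2 * T"
      by (rule gap_decay[OF T T0]) (use that in auto)
    also have "\<dots> \<le> \<gamma> * (1/2) ^ N + 2 * T"
      using that \<gamma> by (intro add_mono mult_left_mono power_decreasing) auto
    also have "\<dots> \<le> E" using \<gamma> by (simp add: E_def)
    finally show ?thesis .
  qed
  have near: "d ((F ^^ (n0 * m)) ?s) (q n0) \<le> E + \<gamma> * (1/2) ^ N"
    by (rule shadow_lim_near) (use e_small E0 in auto)
  have q: "d (q n0) (x (int (n0 * m))) \<le> c * E"
  proof (cases n0)
    case 0
    then show ?thesis using d_refl admissible_in c E0 by (simp add: q_def)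
  next
    case (Suc k)
    have "d (q n0) (x (int (n0 * m))) \<le> c * e k" unfolding Suc by (rule shadow_seq_near)
    also have "\<dots> \<le> c * E" using c Suc by (intro mult_left_mono e_small) auto
    finally show ?thesis .
  qed
  have s: "?s \<in> M" by (rule shadow_lim_properties)
  have "d ((F ^^ (n0 * m)) ?s) (x (int (n0 * m))) \<le> E + \<gamma> * (1/2) ^ N + c * E"
    by (rule d_triangle_le[OF near q Fn_in[OF s] shadow_seq_in admissible_in])
  also have "\<dots> \<le> 5 * c * \<gamma> * (1/2) ^ N + 4 * c * T"
  proof -
    have "\<gamma> * (1/2) ^ N \<le> c * (\<gamma> * (1/2) ^ N)" "T \<le> c * T"
      using c \<gamma> T0 mult_right_mono[of 1 c T] mult_right_mono[of 1 c "\<gamma> * (1/2) ^ N"] by auto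
    then show ?thesis unfolding E_def by (simp add: algebra_simps)
  qed
  finally have base: "d ((F ^^ (n0 * m)) ?s) (x (int (n0 * m))) \<le> 5 * c * \<gamma> * (1/2) ^ N + 4 * c * T" .
  have La: "L ^ a \<le> L ^ m" using L a by (intro power_increasing) auto
  have "d ((F ^^ i) ?s) ((F ^^ a) (x (int (n0 * m)))) \<le> L ^ a * d ((F ^^ (n0 * m)) ?s) (x (int (n0 * m)))"
    using Fn_lipschitz[OF Fn_in[OF s] admissible_in, of a "n0 * m" "int (n0 * m)"]
    by (simp add: i funpow_add add.commute[of _ a])
  also have "\<dots> \<le> L ^ m * (5 * c * \<gamma> * (1/2) ^ N + 4 * c * T)"
    using base La L d_nonneg[OF Fn_in[OF s] admissible_in] by (intro mult_mono) auto
  finally have 1: "d ((F ^^ i) ?s) ((F ^^ a) (x (int (n0 * m)))) \<le> L ^ m * (5 * c * \<gamma> * (1/2) ^ N + 4 * c * T)" .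
  have "d ((F ^^ a) (x (int (n0 * m)))) (x (int (n0 * m + a))) \<le> a * L ^ a * \<theta>"
    using accumulated_error[of "\<lambda>j. x (int j)" "n0 * m" a \<theta>] admissible_in \<theta> err i a
    by (simp add: add_mult_distrib)
  also have "\<dots> \<le> T" unfolding T_def
    using a La L \<theta> by (intro mult_right_mono mult_mono) auto
  also have "T \<le> L ^ m * (c * T)"
  proof -
    have "1 * T \<le> L ^ m * c * T"
      using c one_le_power[OF L, of m] T0 mult_mono[of 1 "L ^ m" 1 c] by (intro mult_right_mono) auto
    then show ?thesis by (simp add: mult.assoc)
  qed
  finally have 2: "d ((F ^^ a) (x (int (n0 * m)))) (x (int i)) \<le> L ^ m * (c * T)" unfolding i .
  have "d ((F ^^ i) ?s) (x (int i))
      \<le> L ^ m * (5 * c * \<gamma> * (1/2) ^ N + 4 * c * T) + L ^ m * (c * T)"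
    by (rule d_triangle_le[OF 1 2 Fn_in[OF s] Fn_in[OF admissible_in] admissible_in])
  also have "\<dots> = L ^ m * (5 * c * \<gamma> * (1/2) ^ N + 5 * c * T)"
    by (simp add: algebra_simps)
  also have "\<dots> \<le> L ^ m * (6 * c * \<gamma> * (1/2) ^ N + 6 * c * T)"
    using c \<gamma> T0 L by (intro mult_left_mono add_mono) auto
  finally show ?thesis by (simp add: T_def)
qed

end

text \<open>
  The window and the tolerance depend on \<open>\<epsilon>\<close> only, not on the time \<open>i\<close>: errors far from \<open>i\<close> are
  forgotten in both directions.
\<close>

lemma shadow_lim_tracks:
  assumes "\<epsilon> > 0"
  obtains K :: nat and \<theta> :: real where "\<theta> > 0" and
    "\<And>x i. admissible M d F m b \<gamma> x \<Longrightarrow>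
       (\<And>j. i \<le> j + K \<Longrightarrow> j \<le> i + K \<Longrightarrow> d (F (x (int j))) (x (int (Suc j))) \<le> \<theta>) \<Longrightarrow>
       d ((F ^^ i) (shadow_lim F F' m b x)) (x (int i)) \<le> \<epsilon>"
proof -
  have Lm: "L ^ m > 0" using L by simp
  obtain N where "(1/2) ^ N < \<epsilon> / (2 * L ^ m * (6 * c * \<gamma>))"
    using real_arch_pow_inv[of "\<epsilon> / (2 * L ^ m * (6 * c * \<gamma>))" "1/2"] \<gamma> c Lm assms by auto
  then have N: "L ^ m * (6 * c * \<gamma> * (1/2) ^ N) \<le> \<epsilon> / 2"
    using \<gamma> c Lm by (simp add: field_simps)
  define \<theta> where "\<theta> = \<epsilon> / (2 * L ^ m * (6 * c * (m * L ^ m)))"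
  have \<theta>: "\<theta> > 0" "L ^ m * (6 * c * (m * L ^ m * \<theta>)) = \<epsilon> / 2"
    using assms Lm c m L by (auto simp: \<theta>_def)
  show ?thesis
  proof (rule that[of \<theta> "(N + 3) * m"])
    fix x i
    assume "admissible M d F m b \<gamma> x" and "\<And>j. i \<le> j + (N + 3) * m \<Longrightarrow> j \<le> i + (N + 3) * m \<Longrightarrow> d (F (x (int j))) (x (int (Suc j))) \<le> \<theta>"
    from one_sided_estimate[where N = N and \<theta> = \<theta>, OF this less_imp_le[OF \<theta>(1)]]
    have "d ((F ^^ i) (shadow_lim F F' m b x)) (x (int i)) \<le>
      L ^ m * (6 * c * \<gamma> * (1/2) ^ N) + L ^ m * (6 * c * (m * L ^ m * \<theta>))"
      by (simp add: distrib_left)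
    then show "d ((F ^^ i) (shadow_lim F F' m b x)) (x (int i)) \<le> \<epsilon>"
      using N \<theta>(2) by linarith
  qed (rule \<theta>)
qed

end

section \<open>Tracking by the two-sided construction\<close>

text \<open>
  This is \<open>shadow_map\<close> with the inverse as a parameter, which makes it symmetric under time reversal.
\<close>

definition bracket_shadow ::
    "('b::t2_space \<Rightarrow> 'b) \<Rightarrow> ('b \<Rightarrow> 'b) \<Rightarrow> nat \<Rightarrow> ('b \<Rightarrow> 'b \<Rightarrow> 'b) \<Rightarrow> (int \<Rightarrow> 'b) \<Rightarrow> 'b" where
  "bracket_shadow F F' m b x =
     b (shadow_lim F' F m (\<lambda>p q. b q p) (\<lambda>i. x (- i))) (shadow_lim F F' m b x)"

definition two_sided_admissible ::
    "'b::t2_space set \<Rightarrow> ('b \<Rightarrow> 'b \<Rightarrow> real) \<Rightarrow> ('b \<Rightarrow> 'b) \<Rightarrow> ('b \<Rightarrow> 'b) \<Rightarrow> nat \<Rightarrow> ('b \<Rightarrow> 'b \<Rightarrow> 'b) \<Rightarrow> real \<Rightarrow>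
     (int \<Rightarrow> 'b) \<Rightarrow> bool" where
  "two_sided_admissible M d F F' m b \<gamma> x \<longleftrightarrow>
     admissible M d F m b \<gamma> x \<and> admissible M d F' m (\<lambda>p q. b q p) \<gamma> (\<lambda>i. x (- i)) \<and>
     d (shadow_lim F' F m (\<lambda>p q. b q p) (\<lambda>i. x (- i))) (shadow_lim F F' m b x) \<le> \<gamma>"

context hyperbolic_system
begin

lemma backward_error:
  assumes "p \<in> M" "q \<in> M"
  shows "d (F' p) q \<le> L * d (F q) p"
  using F'_lipschitz[of p "F q"] F'_F[of q] d_commute[of p "F q"] F_in assms by auto

lemma two_sided_admissible_reversed:
  assumes "two_sided_admissible M d F F' m b \<gamma> x"
  shows "two_sided_admissible M d F' F m (\<lambda>p q. b q p) \<gamma> (\<lambda>i. x (- i))"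
proof -
  interpret rev: hyperbolic_system M F' F d "\<lambda>p q. b q p" L lam c \<gamma> m by (rule reversed)
  show ?thesis
    using assms d_commute[of "shadow_lim F' F m (\<lambda>p q. b q p) (\<lambda>i. x (- i))" "shadow_lim F F' m b x"]
      shadow_lim_properties(1)[of x] rev.shadow_lim_properties(1)[of "\<lambda>i. x (- i)"]
    by (simp add: two_sided_admissible_def)
qed

lemma bracket_shadow_reversed:
  "bracket_shadow F' F m (\<lambda>p q. b q p) (\<lambda>i. x (- i)) = bracket_shadow F F' m b x"
  by (simp add: bracket_shadow_def)

lemma bracket_shadow_in:
  assumes "two_sided_admissible M d F F' m b \<gamma> x"
  shows "bracket_shadow F F' m b x \<in> M"
proof -
  interpret rev: hyperbolic_system M F' F d "\<lambda>p q. b q p" L lam c \<gamma> m by (rule reversed)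
  show ?thesis
    using assms shadow_lim_properties(1)[of x] rev.shadow_lim_properties(1)[of "\<lambda>i. x (- i)"] b_in
    by (simp add: two_sided_admissible_def bracket_shadow_def)
qed

text \<open>
  At a late time \<open>i\<close> the bracket and its second argument have come together, and the second argument is
  close to \<open>x i\<close> by \<open>shadow_lim_tracks\<close>. At an early time the window contains \<open>0\<close>; both one-sided limits are then close to \<open>x 0\<close>, hence so is their
  bracket, and boundedly many steps do not magnify this closeness too much.
\<close>

lemma bracket_shadow_tracks:
  assumes "\<epsilon> > 0"
  obtains K :: nat and \<theta> :: real where "\<theta> > 0" and
    "\<And>x i. two_sided_admissible M d F F' m b \<gamma> x \<Longrightarrow>
       (\<And>j. \<bar>j - int i\<bar> \<le> int K \<Longrightarrow> d (F (x j)) (x (j + 1)) \<le> \<theta>) \<Longrightarrow>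
       d ((F ^^ i) (bracket_shadow F F' m b x)) (x (int i)) \<le> \<epsilon>"
proof -
  interpret rev: hyperbolic_system M F' F d "\<lambda>p q. b q p" L lam c \<gamma> m by (rule reversed)
  obtain K1 :: nat and \<theta>1 :: real where 1: "\<theta>1 > 0" 
    "\<And>x i. admissible M d F m b \<gamma> x \<Longrightarrow>
       (\<And>j. i \<le> j + K1 \<Longrightarrow> j \<le> i + K1 \<Longrightarrow> d (F (x (int j))) (x (int (Suc j))) \<le> \<theta>1) \<Longrightarrow>
       d ((F ^^ i) (shadow_lim F F' m b x)) (x (int i)) \<le> \<epsilon> / 2"
    by (rule shadow_lim_tracks[of "\<epsilon>/2"]) (use assms in auto)
  \<comment> \<open>from time \<open>K0\<close> on, the bracket is \<open>\<epsilon> / 2\<close>-close to its second argument\<close>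
  obtain K0 where "lam ^ K0 < \<epsilon> / (2 * c * \<gamma>)"
    using real_arch_pow_inv[of "\<epsilon> / (2 * c * \<gamma>)" lam] lam c \<gamma> assms by auto
  then have K0: "c * lam ^ K0 * \<gamma> \<le> \<epsilon> / 2" using c \<gamma> by (simp add: field_simps)
  have LK: "1 \<le> L ^ K0" using L by (rule one_le_power)
  \<comment> \<open>closeness of the one-sided limits to \<open>x 0\<close> that survives the bracket and \<open>K0\<close> steps\<close>
  define \<epsilon>' where "\<epsilon>' = \<epsilon> / (2 * ((2 * c + 1) * L ^ K0))"
  have \<epsilon>': "\<epsilon>' > 0" "L ^ K0 * ((2 * c + 1) * \<epsilon>') = \<epsilon> / 2"
    using assms c LK L by (auto simp: \<epsilon>'_def divide_simps)
  obtain K2 :: nat and \<theta>2 :: real where 2: "\<theta>2 > 0" 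
    "\<And>x i. admissible M d F m b \<gamma> x \<Longrightarrow>
       (\<And>j. i \<le> j + K2 \<Longrightarrow> j \<le> i + K2 \<Longrightarrow> d (F (x (int j))) (x (int (Suc j))) \<le> \<theta>2) \<Longrightarrow>
       d ((F ^^ i) (shadow_lim F F' m b x)) (x (int i)) \<le> \<epsilon>'"
    by (rule shadow_lim_tracks[of \<epsilon>']) (use \<epsilon>' in auto)
  obtain K3 :: nat and \<theta>3 :: real where 3: "\<theta>3 > 0" 
    "\<And>x i. admissible M d F' m (\<lambda>p q. b q p) \<gamma> x \<Longrightarrow>
       (\<And>j. i \<le> j + K3 \<Longrightarrow> j \<le> i + K3 \<Longrightarrow> d (F' (x (int j))) (x (int (Suc j))) \<le> \<theta>3) \<Longrightarrow>
       d ((F' ^^ i) (shadow_lim F' F m (\<lambda>p q. b q p) x)) (x (int i)) \<le> \<epsilon>'"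
    by (rule rev.shadow_lim_tracks[of \<epsilon>']) (use \<epsilon>' in auto)
  \<comment> \<open>one-step errors that accumulate to at most \<open>\<epsilon> / 2\<close> in \<open>K0\<close> steps\<close>
  define \<theta>4 where "\<theta>4 = \<epsilon> / (2 * ((K0 + 1) * L ^ K0))"
  have \<theta>4: "\<theta>4 > 0" "(K0 + 1) * L ^ K0 * \<theta>4 = \<epsilon> / 2"
    using assms LK L by (auto simp: \<theta>4_def)
  define \<theta> where "\<theta> = min (min \<theta>1 \<theta>2) (min (\<theta>3 / L) \<theta>4)"
  have \<theta>: "\<theta> > 0" "\<theta> \<le> \<theta>1" "\<theta> \<le> \<theta>2" "\<theta> \<le> \<theta>3 / L" "\<theta> \<le> \<theta>4"
    using 1(1) 2(1) 3(1) \<theta>4(1) L by (auto simp: \<theta>_def)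
  have L\<theta>: "L * \<theta> \<le> \<theta>3"
    using \<theta>(4) L by (simp add: field_simps)
  define K where "K = K0 + K1 + K2 + K3 + 1"
  show ?thesis
  proof (rule that[OF \<theta>(1), of K])
    fix x i
    assume adm: "two_sided_admissible M d F F' m b \<gamma> x"
      and err: "\<And>j. \<bar>j - int i\<bar> \<le> int K \<Longrightarrow> d (F (x j)) (x (j + 1)) \<le> \<theta>"
    let ?p = "shadow_lim F F' m b x"
    let ?m = "shadow_lim F' F m (\<lambda>p q. b q p) (\<lambda>i. x (- i))"
    let ?s = "bracket_shadow F F' m b x"
    have adm1: "admissible M d F m b \<gamma> x" and adm2: "admissible M d F' m (\<lambda>p q. b q p) \<gamma> (\<lambda>i. x (- i))"
      and close: "d ?m ?p \<le> \<gamma>"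
      using adm by (auto simp: two_sided_admissible_def)
    have x: "x j \<in> M" for j using adm1 by (simp add: admissible_def)
    have p: "?p \<in> M" using adm1 by (rule shadow_lim_properties)
    have m': "?m \<in> M" using adm2 by (rule rev.shadow_lim_properties)
    have s: "?s \<in> M" using adm by (rule bracket_shadow_in)
    have err': "d (F (x (int j))) (x (int (Suc j))) \<le> \<theta>" if "\<bar>int j - int i\<bar> \<le> int K" for j
      using err[OF that] by (simp add: add.commute)
    have sp: "d ((F ^^ n) ?s) ((F ^^ n) ?p) \<le> c * lam ^ n * d ?m ?p" for n
      unfolding bracket_shadow_def by (rule b_forward[OF m' p close])
    show "d ((F ^^ i) ?s) (x (int i)) \<le> \<epsilon>"
    proof (cases "K0 \<le> i")
      case True
      have "d ((F ^^ i) ?s) ((F ^^ i) ?p) \<le> c * lam ^ i * d ?m ?p" by (rule sp)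
      also have "\<dots> \<le> c * lam ^ K0 * \<gamma>"
        using close True lam c d_nonneg[OF m' p]
        by (intro mult_mono mult_left_mono power_decreasing) auto
      also have "\<dots> \<le> \<epsilon> / 2" by (rule K0)
      finally have "d ((F ^^ i) ?s) ((F ^^ i) ?p) \<le> \<epsilon> / 2" .
      moreover have "d ((F ^^ i) ?p) (x (int i)) \<le> \<epsilon> / 2"
        by (rule 1(2)[OF adm1], rule order_trans[OF err' \<theta>(2)]) (auto simp: K_def)
      ultimately have "d ((F ^^ i) ?s) (x (int i)) \<le> \<epsilon> / 2 + \<epsilon> / 2"
        by (intro d_triangle_le[OF _ _ Fn_in[OF s] Fn_in[OF p] x])
      then show ?thesis by simp
    next
      case False
      have "d ((F ^^ 0) ?p) (x (int 0)) \<le> \<epsilon>'"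
        by (rule 2(2)[OF adm1], rule order_trans[OF err' \<theta>(3)]) (use False in \<open>auto simp: K_def\<close>)
      then have p0: "d ?p (x 0) \<le> \<epsilon>'" by simp
      have "d ((F' ^^ 0) ?m) (x (- int 0)) \<le> \<epsilon>'"
      proof (rule 3(2)[OF adm2])
        fix j assume "j \<le> 0 + K3"
        have "d (F' (x (- int j))) (x (- int (Suc j))) \<le> L * d (F (x (- int (Suc j)))) (x (- int j))"
          by (intro backward_error x)
        also have "\<dots> \<le> L * \<theta>"
          using L err[of "- int (Suc j)"] False \<open>j \<le> 0 + K3\<close>
          by (intro mult_left_mono) (auto simp: K_def)
        also have "\<dots> \<le> \<theta>3" by (rule L\<theta>)
        finally show "d (F' (x (- int j))) (x (- int (Suc j))) \<le> \<theta>3" .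
      qed
      then have m0: "d ?m (x 0) \<le> \<epsilon>'" by simp
      have mp: "d ?m ?p \<le> \<epsilon>' + \<epsilon>'"
        using p0 by (intro d_triangle_le[OF m0 _ m' x p]) (simp add: d_commute[OF x p])
      have "d ?s ?p \<le> c * (\<epsilon>' + \<epsilon>')"
        using sp[of 0] order_trans[OF _ mult_left_mono[OF mp]] c by simp
      then have "d ?s (x 0) \<le> c * (\<epsilon>' + \<epsilon>') + \<epsilon>'"
        by (rule d_triangle_le[OF _ p0 s p x])
      then have s0: "d ?s (x 0) \<le> (2 * c + 1) * \<epsilon>'" by (simp add: algebra_simps)
      have Li: "L ^ i \<le> L ^ K0" using L False by (intro power_increasing) auto
      have "d ((F ^^ i) ?s) ((F ^^ i) (x 0)) \<le> L ^ i * d ?s (x 0)"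
        by (rule Fn_lipschitz[OF s x])
      also have "\<dots> \<le> L ^ K0 * ((2 * c + 1) * \<epsilon>')"
        using s0 Li LK d_nonneg[OF s x] by (intro mult_mono) auto
      also have "\<dots> = \<epsilon> / 2" by (rule \<epsilon>')
      finally have a: "d ((F ^^ i) ?s) ((F ^^ i) (x 0)) \<le> \<epsilon> / 2" .
      have "d ((F ^^ i) (x (int 0))) (x (int (0 + i))) \<le> i * L ^ i * \<theta>"
        by (rule accumulated_error[of "\<lambda>j. x (int j)", OF x err'])
           (use \<theta>(1) False in \<open>auto simp: K_def\<close>)
      also have "\<dots> \<le> (K0 + 1) * L ^ K0 * \<theta>4"
        using False Li LK L \<theta>(1,5) by (intro mult_mono) auto
      also have "\<dots> = \<epsilon> / 2" by (rule \<theta>4)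
      finally have "d ((F ^^ i) (x 0)) (x (int i)) \<le> \<epsilon> / 2" by simp
      from d_triangle_le[OF a this Fn_in[OF s] Fn_in[OF x] x] show ?thesis by simp
    qed
  qed
qed

end


section \<open>Self-tuning\<close>

lemma inv_shift_funpow: "(inv_into UNIV shift ^^ n) x = (\<lambda>j. x (j - int n))"
proof (induction n)
  case (Suc n)
  have inj: "inj (shift :: (int \<Rightarrow> 'b) \<Rightarrow> _)"
  proof (rule injI)
    fix y z :: "int \<Rightarrow> 'b" assume "shift y = shift z"
    then have "y (j - 1 + 1) = z (j - 1 + 1)" for j unfolding shift_def by meson
    then show "y = z" by auto
  qed
  have "inv_into UNIV shift y = (\<lambda>j. y (j - 1))" for y :: "int \<Rightarrow> 'b"
  proof -
    have "y = shift (\<lambda>j. y (j - 1))" by (simp add: shift_def)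
    then show ?thesis using inv_f_f[OF inj] by metis
  qed
  then have "(inv_into UNIV shift ^^ Suc n) x = (\<lambda>j. x (j - 1 - int n))" using Suc by simp
  then show ?case by (simp add: algebra_simps)
qed simp

lemma zpow_shift: "zpow UNIV shift i x = (\<lambda>j. x (j + i))"
proof -
  have "(shift ^^ n) x = (\<lambda>j. x (j + int n))" for n
    by (induction n) (auto simp: shift_def algebra_simps)
  then show ?thesis
    by (auto simp: zpow_def inv_shift_funpow)
qed

lemma pseudo_orbits_shift:
  "x \<in> pseudo_orbits M d f \<delta> \<Longrightarrow> (\<lambda>j. x (j + i)) \<in> pseudo_orbits M d f \<delta>"
proof -
  assume x: "x \<in> pseudo_orbits M d f \<delta>"
  have "d (x (j + 1 + i)) (f (x (j + i))) \<le> \<delta>" for j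
    using x by (auto simp: pseudo_orbits_def ac_simps dest: spec[of _ "j + i"])
  then show ?thesis using x by (auto simp: pseudo_orbits_def)
qed

lemma summable_on_geometric_int:
  assumes "0 < \<mu>" "\<mu> < (1::real)"
  shows "(\<lambda>i::int. \<mu> ^ nat \<bar>i\<bar>) summable_on UNIV"
proof -
  have nat: "(\<lambda>n::nat. \<mu> ^ n) summable_on UNIV"
    using assms by (intro norm_summable_imp_summable_on) simp
  have 1: "(\<lambda>i::int. \<mu> ^ nat \<bar>i\<bar>) summable_on (range int)"
    by (subst summable_on_reindex) (use nat in \<open>auto simp: o_def\<close>)
  have 2: "(\<lambda>i::int. \<mu> ^ nat \<bar>i\<bar>) summable_on (range (\<lambda>n. - int n))"
    by (subst summable_on_reindex) (use nat in \<open>auto simp: o_def inj_def\<close>)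
  have "UNIV = range int \<union> range (\<lambda>n. - int n)"
    by (auto intro: int_cases2)
  then show ?thesis using summable_on_union[OF 1 2] by simp
qed

text \<open>
  The bound \<open>D\<close> makes the weighted sum converge; the value of a divergent \<open>infsum\<close> is \<open>0\<close>.
\<close>

lemma seq_dist_term_le:
  assumes "0 < \<mu>" "\<mu> < 1" and "\<And>i. 0 \<le> d (x i) (y i)" "\<And>i. d (x i) (y i) \<le> D"
  shows "\<mu> ^ nat \<bar>j\<bar> * d (x j) (y j) \<le> seq_dist d \<mu> x y"
proof -
  have s: "(\<lambda>i::int. \<mu> ^ nat \<bar>i\<bar> * D) summable_on UNIV"
    by (intro summable_on_cmult_left summable_on_geometric_int assms)
  have "(\<lambda>i::int. \<mu> ^ nat \<bar>i\<bar> * d (x i) (y i)) summable_on UNIV"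
    by (rule summable_on_comparison_test[OF s]) (use assms in \<open>auto intro: mult_left_mono\<close>)
  from finite_sum_le_infsum[OF this, of "{j}"] show ?thesis
    using assms by (simp add: seq_dist_def)
qed

context hyperbolic_system
begin

lemma zpow_in: "F' = inv_into M F \<Longrightarrow> p \<in> M \<Longrightarrow> zpow M F i p \<in> M"
  using Fn_in F'n_in by (auto simp: zpow_def)

lemma F_zpow:
  assumes "F' = inv_into M F" "p \<in> M"
  shows "F (zpow M F i p) = zpow M F (i + 1) p"
proof (cases "0 \<le> i")
  case True
  then show ?thesis by (simp add: zpow_def nat_add_distrib)
next
  case False
  then obtain n where "i = - int (Suc n)" by (metis int_cases linorder_not_le of_nat_0_le_iff)
  moreover have "F (F' ((F' ^^ n) p)) = (F' ^^ n) p" using assms F_F' F'n_in by blast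
  ultimately show ?thesis using assms(1) by (cases n) (auto simp: zpow_def nat_add_distrib)
qed

lemma two_sided_admissible_pseudo_orbit:
  assumes F': "F' = inv_into M F" and "shadow_brackets_defined M d F \<delta> \<gamma> m b"
    and x: "x \<in> pseudo_orbits M d F \<delta>"
  shows "two_sided_admissible M d F F' m b \<gamma> x"
  using assms(2,3) d_commute unfolding two_sided_admissible_def shadow_brackets_defined_def
    admissible_def close_pairs_def F'[symmetric] shadow_minus_def shadow_plus_def pseudo_orbits_def
  by fastforce

text \<open>
  Closeness of \<open>\<sigma>\<^sup>i(x)\<close> to the orbit of \<open>x i\<close> makes the one-step errors of \<open>x\<close> small in a window around
  \<open>i\<close>. Tracking then applies to \<open>x\<close> at the time \<open>i\<close>, in reversed time if \<open>i < 0\<close>, and to \<open>\<sigma>\<^sup>i(x)\<close> at the time \<open>0\<close>. Both of the points that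
  are to be compared are thus close to \<open>x i\<close>.
\<close>

theorem self_tuning_shadow_map:
  assumes F': "F' = inv_into M F" and \<mu>: "0 < \<mu>" "\<mu> < 1"
    and bounded: "\<And>p q. p \<in> M \<Longrightarrow> q \<in> M \<Longrightarrow> d p q \<le> D"
    and brackets: "shadow_brackets_defined M d F \<delta> \<gamma> m b"
  shows "self_tuning M d \<mu> F \<delta> (shadow_map M F m b)"
  unfolding self_tuning_def
proof (intro allI impI)
  interpret rev: hyperbolic_system M F' F d "\<lambda>p q. b q p" L lam c \<gamma> m by (rule reversed)
  have Sh: "shadow_map M F m b x = bracket_shadow F F' m b x" for x
    by (simp add: shadow_map_def bracket_shadow_def shadow_minus_def shadow_plus_def F'[symmetric])
  fix \<epsilon> :: real assume \<epsilon>: "\<epsilon> > 0"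
  obtain K1 :: nat and \<theta>1 :: real where 1: "\<theta>1 > 0" 
    "\<And>x i. two_sided_admissible M d F F' m b \<gamma> x \<Longrightarrow>
       (\<And>j. \<bar>j - int i\<bar> \<le> int K1 \<Longrightarrow> d (F (x j)) (x (j + 1)) \<le> \<theta>1) \<Longrightarrow>
       d ((F ^^ i) (bracket_shadow F F' m b x)) (x (int i)) \<le> \<epsilon> / 2"
    by (rule bracket_shadow_tracks[of "\<epsilon> / 2"]) (use \<epsilon> in auto)
  obtain K2 :: nat and \<theta>2 :: real where 2: "\<theta>2 > 0" 
    "\<And>x i. two_sided_admissible M d F' F m (\<lambda>p q. b q p) \<gamma> x \<Longrightarrow>
       (\<And>j. \<bar>j - int i\<bar> \<le> int K2 \<Longrightarrow> d (F' (x j)) (x (j + 1)) \<le> \<theta>2) \<Longrightarrow>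
       d ((F' ^^ i) (bracket_shadow F' F m (\<lambda>p q. b q p) x)) (x (int i)) \<le> \<epsilon> / 2"
    by (rule rev.bracket_shadow_tracks[of "\<epsilon> / 2"]) (use \<epsilon> in auto)
  define \<theta> where "\<theta> = min \<theta>1 (\<theta>2 / L)"
  have \<theta>: "\<theta> > 0" "\<theta> \<le> \<theta>1" "L * \<theta> \<le> \<theta>2"
    using 1(1) 2(1) L by (auto simp: \<theta>_def min_def field_simps)
  \<comment> \<open>one more than \<open>K1 + K2\<close>, since a backward step at \<open>j\<close> is a forward step at \<open>j - 1\<close>\<close>
  define K where "K = K1 + K2 + 1"
  \<comment> \<open>the least weight in the window; a one-step error is at most \<open>1 + L\<close> times the distance to the orbit\<close>
  define \<eta> where "\<eta> = \<mu> ^ (K + 1) * (\<theta> / (1 + L))"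
  have \<eta>: "\<eta> > 0" using \<mu> \<theta> L by (simp add: \<eta>_def)
  have "d (zpow M F i (shadow_map M F m b x)) (shadow_map M F m b (zpow UNIV shift i x)) \<le> \<epsilon>"
    if x: "x \<in> pseudo_orbits M d F \<delta>" and close: "seq_dist d \<mu> (zpow UNIV shift i x) (orb M F (x i)) < \<eta>"
    for x i
  proof -
    let ?y = "\<lambda>j. x (j + i)"
    have xM: "x j \<in> M" for j using x by (simp add: pseudo_orbits_def)
    have admx: "two_sided_admissible M d F F' m b \<gamma> x"
      by (rule two_sided_admissible_pseudo_orbit[OF F' brackets x])
    have admy: "two_sided_admissible M d F F' m b \<gamma> ?y"
      by (rule two_sided_admissible_pseudo_orbit[OF F' brackets pseudo_orbits_shift[OF x]])
    have near: "d (x (j + i)) (zpow M F j (x i)) \<le> \<theta> / (1 + L)" if "\<bar>j\<bar> \<le> int K + 1" for j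
    proof -
      have "\<mu> ^ nat \<bar>j\<bar> * d (?y j) (orb M F (x i) j) \<le> seq_dist d \<mu> ?y (orb M F (x i))"
        using d_nonneg bounded xM zpow_in[OF F']
        by (intro seq_dist_term_le[where D = D, OF \<mu>]) (auto simp: orb_def)
      then have "\<mu> ^ nat \<bar>j\<bar> * d (?y j) (orb M F (x i) j) < \<eta>" using close by (simp add: zpow_shift)
      moreover have "\<mu> ^ (K + 1) * d (?y j) (orb M F (x i) j) \<le> \<mu> ^ nat \<bar>j\<bar> * d (?y j) (orb M F (x i) j)"
        using \<mu> that d_nonneg xM zpow_in[OF F']
        by (intro mult_right_mono power_decreasing) (auto simp: orb_def)
      ultimately have "\<mu> ^ (K + 1) * d (?y j) (orb M F (x i) j) < \<mu> ^ (K + 1) * (\<theta> / (1 + L))"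
        unfolding \<eta>_def by linarith
      then have "d (?y j) (orb M F (x i) j) < \<theta> / (1 + L)"
        by (rule mult_left_less_imp_less) (use \<mu> in simp)
      then show ?thesis by (simp add: orb_def)
    qed
    have err: "d (F (x j)) (x (j + 1)) \<le> \<theta>" if "\<bar>j - i\<bar> \<le> int K" for j
    proof -
      let ?z = "zpow M F (j - i) (x i)"
      have z: "?z \<in> M" using zpow_in[OF F' xM] .
      have "d (F (x j)) (F ?z) \<le> L * d (x j) ?z" by (rule F_lipschitz[OF xM z])
      also have "\<dots> \<le> L * (\<theta> / (1 + L))"
        using near[of "j - i"] that L by (intro mult_left_mono) auto
      finally have a: "d (F (x j)) (F ?z) \<le> L * (\<theta> / (1 + L))" .
      have "F ?z = zpow M F (j - i + 1) (x i)" by (rule F_zpow[OF F' xM])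
      then have c: "d (F ?z) (x (j + 1)) \<le> \<theta> / (1 + L)"
        using near[of "j - i + 1"] that d_commute[OF F_in[OF z] xM] by (simp add: algebra_simps)
      have "d (F (x j)) (x (j + 1)) \<le> L * (\<theta> / (1 + L)) + \<theta> / (1 + L)"
        by (rule d_triangle_le[OF a c F_in[OF xM] F_in[OF z] xM])
      also have "\<dots> = (1 + L) * (\<theta> / (1 + L))" by (simp only: distrib_right mult_1_left add.commute)
      also have "\<dots> = \<theta>" using L by simp
      finally show ?thesis .
    qed
    have "d (zpow M F i (bracket_shadow F F' m b x)) (x i) \<le> \<epsilon> / 2"
    proof (cases "0 \<le> i")
      case True
      then obtain n where i: "i = int n" by (metis nonneg_int_cases)
      have "d ((F ^^ n) (bracket_shadow F F' m b x)) (x (int n)) \<le> \<epsilon> / 2"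
        by (rule 1(2)[OF admx], rule order_trans[OF err \<theta>(2)]) (auto simp: K_def i)
      then show ?thesis by (simp add: i zpow_def)
    next
      case False
      then obtain n where i: "i = - int n" by (metis int_cases2 of_nat_0_le_iff)
      have n: "n > 0" using False i by simp
      have "d ((F' ^^ n) (bracket_shadow F' F m (\<lambda>p q. b q p) (\<lambda>i. x (- i)))) (x (- int n)) \<le> \<epsilon> / 2"
      proof (rule 2(2)[OF two_sided_admissible_reversed[OF admx]])
        fix j :: int assume j: "\<bar>j - int n\<bar> \<le> int K2"
        have "d (F' (x (- j))) (x (- (j + 1))) \<le> L * d (F (x (- (j + 1)))) (x (- j))"
          by (rule backward_error[OF xM xM])
        also have "\<dots> \<le> L * \<theta>"
          using L err[of "- (j + 1)"] j by (intro mult_left_mono) (auto simp: K_def i)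
        also have "\<dots> \<le> \<theta>2" by (rule \<theta>)
        finally show "d (F' (x (- j))) (x (- (j + 1))) \<le> \<theta>2" .
      qed
      then show ?thesis using n by (simp add: i zpow_def bracket_shadow_reversed F'[symmetric])
    qed
    moreover have "d ((F ^^ 0) (bracket_shadow F F' m b ?y)) (?y (int 0)) \<le> \<epsilon> / 2"
    proof (rule 1(2)[OF admy])
      fix j assume "\<bar>j - int 0\<bar> \<le> int K1"
      then show "d (F (x (j + i))) (x (j + 1 + i)) \<le> \<theta>1"
        using err[of "j + i"] \<theta>(2) by (simp add: K_def ac_simps)
    qed
    then have "d (x i) (bracket_shadow F F' m b ?y) \<le> \<epsilon> / 2"
      using d_commute[OF xM bracket_shadow_in[OF admy]] by simp
    ultimately have "d (zpow M F i (bracket_shadow F F' m b x)) (bracket_shadow F F' m b ?y) \<le> \<epsilon> / 2 + \<epsilon> / 2"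
      using zpow_in[OF F' bracket_shadow_in[OF admx]] xM bracket_shadow_in[OF admy]
      by (rule d_triangle_le)
    then show ?thesis by (simp add: Sh zpow_shift)
  qed
  with \<eta> show "\<exists>\<eta>>0. \<forall>x\<in>pseudo_orbits M d F \<delta>. \<forall>i.
        seq_dist d \<mu> (zpow UNIV shift i x) (orb M F (x i)) < \<eta> \<longrightarrow>
        d (zpow M F i (shadow_map M F m b x)) (shadow_map M F m b (zpow UNIV shift i x)) \<le> \<epsilon>"
    by blast
qed

end

section \<open>Pseudo-orbits with a single jump\<close>

lemma shadow_lim_of_orbit:
  assumes "\<And>n. shadow_seq F m b x n = (F ^^ (n * m)) z" and "\<And>n. (F' ^^ n) ((F ^^ n) z) = z"
  shows "shadow_lim F F' m b x = z"
  by (simp add: shadow_lim_def assms)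

context inverse_pair
begin

text \<open>
  In the backward construction for \<open>x\<close> and in the forward construction for the shifted sequence the
  brackets compare the two orbits. The former does so at the times \<open>-m\<close>, \<open>-2m\<close> and so
  on, when the orbit of \<open>p\<close> is in \<open>P\<close>, and stays on the orbit of \<open>q\<close>, on which it starts. The
  latter does so at the times \<open>m - 1\<close>, \<open>2m - 1\<close> and so on of \<open>x\<close>, when the orbit of \<open>p\<close> is
  in \<open>Q\<close>, and stays on the orbit of \<open>p\<close>, on which it starts. The other two constructions only ever see one orbit.
  With \<open>m = Suc k\<close> the first of the latter times is \<open>k\<close>.
\<close>

lemma shadow_map_of_jump:
  assumes F': "F' = inv_into M F"
    and brackets: "shadow_brackets_defined M d F \<delta> \<gamma> (Suc k) br"
    and idem: "\<And>z. z \<in> M \<Longrightarrow> br z z = z"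
    and P: "\<And>v w. v \<in> P \<Longrightarrow> (v, w) \<in> close_pairs M d \<gamma> \<Longrightarrow> br v w = w"
    and Q: "\<And>v w. v \<in> Q \<Longrightarrow> (v, w) \<in> close_pairs M d \<gamma> \<Longrightarrow> br v w = v"
    and p: "p \<in> M" "\<And>n. (F' ^^ Suc n) p \<in> P" "\<And>n. (F ^^ (n + k)) p \<in> Q" and q: "q \<in> M"
    and x_def: "x = (\<lambda>i. zpow M F i (if i < 0 then p else q))"
    and x: "x \<in> pseudo_orbits M d F \<delta>"
  shows "shadow_map M F (Suc k) br x = q" 
    and "shadow_map M F (Suc k) br (\<lambda>i. x (i + - 1)) = F' p"
proof -
  let ?m = "Suc k"
  let ?y = "\<lambda>i. x (i + - 1)"
  let ?br' = "\<lambda>p q. br q p"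
  have y: "?y \<in> pseudo_orbits M d F \<delta>" by (rule pseudo_orbits_shift[OF x])
  have pos: "x (int n) = (F ^^ n) q" for n by (simp add: x_def zpow_def)
  have neg: "x (- int (Suc n)) = (F' ^^ Suc n) p" for n
    by (simp add: x_def zpow_def F' nat_add_distrib del: funpow.simps)
  have "shadow_seq F ?m br x n = (F ^^ (n * ?m)) q" for n
  proof (induction n)
    case 0
    then show ?case using pos[of 0] by simp
  next
    case (Suc n)
    have "(F ^^ ?m) ((F ^^ (n * ?m)) q) = (F ^^ (Suc n * ?m)) q" by (simp only: mult_Suc funpow_add o_apply)
    then show ?case by (simp only: shadow_seq.simps Suc pos idem[OF Fn_in[OF q]])
  qed
  then have plus: "shadow_plus M F ?m br x = q"
    unfolding shadow_plus_def F'[symmetric] by (rule shadow_lim_of_orbit) (rule F'n_Fn[OF q])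
  have "shadow_seq F' ?m ?br' (\<lambda>i. x (- i)) n = (F' ^^ (n * ?m)) q" for n
  proof (induction n)
    case 0
    then show ?case using pos[of 0] by simp
  next
    case (Suc n)
    have 1: "(F' ^^ ?m) ((F' ^^ (n * ?m)) q) = (F' ^^ (Suc n * ?m)) q" by (simp only: mult_Suc funpow_add o_apply)
    have "x (- int (Suc n * ?m)) \<in> P"
      using neg[of "k + n * ?m"] p(2)[of "k + n * ?m"] by (simp only: mult_Suc add_Suc)
    moreover have "(x (- int (Suc n * ?m)), (F' ^^ ?m) (shadow_seq F' ?m ?br' (\<lambda>i. x (- i)) n)) \<in> close_pairs M d \<gamma>"
      using brackets x unfolding shadow_brackets_defined_def F'[symmetric] by blast
    ultimately show ?case using P by (simp only: shadow_seq.simps Suc 1)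
  qed
  then have "shadow_minus M F ?m br x = q"
    unfolding shadow_minus_def F'[symmetric] by (rule shadow_lim_of_orbit) (rule Fn_F'n[OF q])
  with plus show "shadow_map M F ?m br x = q" by (simp add: shadow_map_def idem[OF q])

  let ?z = "F' p"
  have z: "?z \<in> M" by (rule F'_in[OF p(1)])
  have yneg: "?y (- int n) = (F' ^^ n) ?z" for n
  proof -
    have "?y (- int n) = x (- int (Suc n))" by (simp add: algebra_simps)
    also have "\<dots> = (F' ^^ Suc n) p" by (rule neg)
    finally show ?thesis by (simp add: funpow_swap1)
  qed
  have "shadow_seq F' ?m ?br' (\<lambda>i. ?y (- i)) n = (F' ^^ (n * ?m)) ?z" for n
  proof (induction n)
    case 0
    then show ?case using yneg[of 0] by simp
  next
    case (Suc n)
    have "(F' ^^ ?m) ((F' ^^ (n * ?m)) ?z) = (F' ^^ (Suc n * ?m)) ?z" by (simp only: mult_Suc funpow_add o_apply)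
    then show ?case by (simp only: shadow_seq.simps Suc yneg idem[OF F'n_in[OF z]])
  qed
  then have minus: "shadow_minus M F ?m br ?y = ?z"
    unfolding shadow_minus_def F'[symmetric] by (rule shadow_lim_of_orbit) (rule Fn_F'n[OF z])
  have "shadow_seq F ?m br ?y n = (F ^^ (n * ?m)) ?z" for n
  proof (induction n)
    case 0
    then show ?case using yneg[of 0] by simp
  next
    case (Suc n)
    have 1: "(F ^^ ?m) ((F ^^ (n * ?m)) ?z) = (F ^^ (Suc n * ?m)) ?z" by (simp only: mult_Suc funpow_add o_apply)
    have "(F ^^ (Suc n * ?m)) ?z = (F ^^ (n * ?m + k)) (F ?z)"
      by (simp add: funpow_swap1 ac_simps)
    then have "(F ^^ (Suc n * ?m)) ?z \<in> Q" using p(3) F_F'[OF p(1)] by simp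
    moreover have "((F ^^ ?m) (shadow_seq F ?m br ?y n), ?y (int (Suc n * ?m))) \<in> close_pairs M d \<gamma>"
      using brackets y unfolding shadow_brackets_defined_def by blast
    ultimately show ?case using Q by (simp only: shadow_seq.simps Suc 1)
  qed
  then have plus: "shadow_plus M F ?m br ?y = ?z"
    unfolding shadow_plus_def F'[symmetric] by (rule shadow_lim_of_orbit) (rule F'n_Fn[OF z])
  show "shadow_map M F ?m br ?y = F' p"
    by (simp only: shadow_map_def plus minus idem[OF z])
qed

lemma jump_pseudo_orbit:
  assumes F': "F' = inv_into M F"
    and refl: "\<And>z. z \<in> M \<Longrightarrow> d z z = 0" and p: "p \<in> M" and q: "q \<in> M" and jump: "d q p \<le> \<delta>" and nonneg: "0 \<le> \<delta>"
  shows "(\<lambda>i. zpow M F i (if i < 0 then p else q)) \<in> pseudo_orbits M d F \<delta>"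
proof -
  let ?x = "\<lambda>i. zpow M F i (if i < 0 then p else q)"
  have "?x i \<in> M" for i using Fn_in F'n_in p q by (auto simp: zpow_def F'[symmetric])
  moreover have "d (?x (i + 1)) (F (?x i)) \<le> \<delta>" for i
  proof (cases "0 \<le> i")
    case True
    then show ?thesis using refl F_in Fn_in q nonneg by (simp add: zpow_def nat_add_distrib)
  next
    case False
    then obtain n where i: "i = - int (Suc n)"
      by (metis int_cases linorder_not_le of_nat_0_le_iff)
    show ?thesis
    proof (cases n)
      case 0
      then show ?thesis using jump F_F' p i by (simp add: zpow_def F'[symmetric])
    next
      case (Suc l)
      then have "?x (i + 1) = (F' ^^ n) p" "?x i = F' ((F' ^^ n) p)"
        using i by (simp_all add: zpow_def F'[symmetric] nat_add_distrib)
      then show ?thesis using refl F'n_in F_F' p nonneg by simp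
    qed
  qed
  ultimately show ?thesis by (simp add: pseudo_orbits_def)
qed

end

section \<open>The Riemannian distance on the sphere\<close>

lemma tangent_space_scaleR: "v \<in> tangent_space p \<Longrightarrow> a *\<^sub>R v \<in> tangent_space p"
  by (simp add: tangent_space_def)

lemma tangential_part_in_tangent_space:
  "p \<in> usphere \<Longrightarrow> v - (p \<bullet> v) *\<^sub>R p \<in> tangent_space p"
  by (simp add: tangent_space_def inner_diff_right dot_square_norm)

lemma metric_ext_on_sphere:
  "p \<in> usphere \<Longrightarrow> metric_ext g p v w = g p (v - (p \<bullet> v) *\<^sub>R p) (w - (p \<bullet> w) *\<^sub>R p)"
  by (simp add: metric_ext_def sgn_div_norm)

lemma metric_ext_tangent:
  "p \<in> usphere \<Longrightarrow> v \<in> tangent_space p \<Longrightarrow> w \<in> tangent_space p \<Longrightarrow> metric_ext g p v w = g p v w"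
  by (simp add: metric_ext_on_sphere tangent_space_def)

text \<open>
  The factors \<open>-1\<close> and \<open>2\<close> are those by which the velocity of a curve changes when the curve is
  reversed or becomes half of a joined curve.
\<close>

lemma riem_norm_scaleR:
  assumes "riemannian_metric g" "p \<in> usphere" "v \<in> tangent_space p"
  shows "riem_norm g p (a *\<^sub>R v) = \<bar>a\<bar> * riem_norm g p v"
proof -
  have lin: "g p (a *\<^sub>R v) w = a * g p v w" if "w \<in> tangent_space p" for w
  proof -
    have "g p (a *\<^sub>R v + 0 *\<^sub>R v) w = a * g p v w + 0 * g p v w"
      using assms that unfolding riemannian_metric_def by blast
    then show ?thesis by simp
  qed
  have sym: "g p v w = g p w v" if "v \<in> tangent_space p" "w \<in> tangent_space p" for v w
    using assms that by (simp add: riemannian_metric_def)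
  have "g p (a *\<^sub>R v) (a *\<^sub>R v) = a\<^sup>2 * g p v v"
    using lin[of "a *\<^sub>R v"] lin[of v] sym[of v "a *\<^sub>R v"] assms
    by (simp add: tangent_space_scaleR power2_eq_square)
  then show ?thesis by (simp add: riem_norm_def real_sqrt_mult)
qed

lemma linear_metric_ext:
  assumes "riemannian_metric g" "p \<in> usphere"
  shows "linear (\<lambda>v. metric_ext g p v w)"
proof -
  have comb: "metric_ext g p (a *\<^sub>R v + b *\<^sub>R v') w = a * metric_ext g p v w + b * metric_ext g p v' w" for a b v v'
  proof -
    let ?T = "\<lambda>v. v - (p \<bullet> v) *\<^sub>R p"
    have "?T (a *\<^sub>R v + b *\<^sub>R v') = a *\<^sub>R ?T v + b *\<^sub>R ?T v'"
      by (simp add: inner_add_right algebra_simps)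
    then show ?thesis
      using assms tangential_part_in_tangent_space[OF assms(2)]
      unfolding metric_ext_on_sphere[OF assms(2)] riemannian_metric_def by metis
  qed
  show ?thesis
  proof
    show "metric_ext g p (v + v') w = metric_ext g p v w + metric_ext g p v' w" for v v'
      using comb[of 1 v 1 v'] by simp
    show "metric_ext g p (a *\<^sub>R v) w = a *\<^sub>R metric_ext g p v w" for a v
      using comb[of a v 0 v] by simp
  qed
qed

lemma metric_ext_commute:
  assumes "riemannian_metric g" "p \<in> usphere"
  shows "metric_ext g p v w = metric_ext g p w v"
  using assms tangential_part_in_tangent_space[OF assms(2)]
  unfolding metric_ext_on_sphere[OF assms(2)] riemannian_metric_def by blast

text \<open>
  Smoothness of the metric is a statement about each pair of constant vectors. The expansion in
  coordinates turns it into continuity in the point and the vectors jointly.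
\<close>

lemma metric_ext_expand:
  assumes "riemannian_metric g" "p \<in> usphere"
  shows "metric_ext g p v w = (\<Sum>i\<in>Basis. \<Sum>j\<in>Basis. (v \<bullet> i) * ((w \<bullet> j) * metric_ext g p i j))"
proof -
  have exp: "metric_ext g p v w = (\<Sum>i\<in>Basis. (v \<bullet> i) * metric_ext g p i w)" for v w
  proof -
    interpret linear "\<lambda>v. metric_ext g p v w" by (rule linear_metric_ext[OF assms])
    have "metric_ext g p (\<Sum>i\<in>Basis. (v \<bullet> i) *\<^sub>R i) w = (\<Sum>i\<in>Basis. (v \<bullet> i) * metric_ext g p i w)"
      by (simp add: sum scale)
    then show ?thesis by (simp add: euclidean_representation)
  qed
  have "metric_ext g p i w = (\<Sum>j\<in>Basis. (w \<bullet> j) * metric_ext g p i j)" for i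
    using exp[of w i] metric_ext_commute[OF assms] by simp
  then show ?thesis by (subst exp) (simp add: sum_distrib_left)
qed

lemma continuous_on_metric_ext:
  assumes "riemannian_metric g"
  shows "continuous_on (usphere \<times> UNIV) (\<lambda>(p, v). metric_ext g p v v)"
proof -
  have "continuous_on (- {0}) (\<lambda>x. metric_ext g x i j)" for i j
  proof -
    have "Ck_on 0 (- {0}) (\<lambda>x. metric_ext g x i j)"
      using assms unfolding riemannian_metric_def smooth_on_def by blast
    then show ?thesis by simp
  qed
  then have "continuous_on usphere (\<lambda>x. metric_ext g x i j)" for i j
    by (rule continuous_on_subset) auto
  then have "continuous_on (usphere \<times> UNIV) (\<lambda>y. metric_ext g (fst y) i j)" for i j
    by (rule continuous_on_compose2) (auto intro: continuous_intros)
  then have "continuous_on (usphere \<times> UNIV)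
     (\<lambda>y. \<Sum>i\<in>Basis. \<Sum>j\<in>Basis. (snd y \<bullet> i) * ((snd y \<bullet> j) * metric_ext g (fst y) i j))"
    by (intro continuous_intros)
  then show ?thesis
    by (rule continuous_on_eq) (use assms in \<open>auto simp: metric_ext_expand[symmetric]\<close>)
qed

text \<open>
  On the unit tangent bundle, which is compact, the Riemannian norm attains a positive minimum and
  a maximum.
\<close>

lemma riem_norm_equivalent:
  fixes g :: "'a::euclidean_space \<Rightarrow> 'a \<Rightarrow> 'a \<Rightarrow> real"
  assumes g: "riemannian_metric g" and dim: "2 \<le> DIM('a)"
  obtains a b where "0 < a" "0 < b"
    "\<And>p v. p \<in> usphere \<Longrightarrow> v \<in> tangent_space p \<Longrightarrow> a * norm v \<le> riem_norm g p v \<and> riem_norm g p v \<le> b * norm v"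
proof -
  let ?K = "(usphere \<times> usphere) \<inter> {(p, v). p \<bullet> v = 0} :: ('a \<times> 'a) set"
  let ?N = "\<lambda>(p, v). riem_norm g p v"
  have "closed {(p :: 'a, v :: 'a). p \<bullet> v = 0}"
    unfolding split_def by (intro closed_Collect_eq continuous_intros)
  then have K: "compact ?K"
    by (intro compact_Int_closed compact_Times compact_sphere)
  have "continuous_on ?K (\<lambda>y. sqrt ((\<lambda>(p, v). metric_ext g p v v) y))"
    by (intro continuous_on_real_sqrt continuous_on_subset[OF continuous_on_metric_ext[OF g]]) auto
  then have cont: "continuous_on ?K ?N"
    by (rule continuous_on_eq) (auto simp: riem_norm_def metric_ext_tangent tangent_space_def)
  obtain p0 :: 'a where p0: "p0 \<in> usphere"
    using vector_choose_size[of 1] by (metis mem_sphere_0 zero_le_one)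
  obtain v0 where v0: "v0 \<noteq> 0" "orthogonal p0 v0" using orthogonal_to_vector_exists[OF dim] by blast
  have "(p0, sgn v0) \<in> ?K"
    using p0 v0 by (simp add: orthogonal_def sgn_div_norm)
  then have ne: "?K \<noteq> {}" by blast
  obtain y1 where y1: "y1 \<in> ?K" "\<And>y. y \<in> ?K \<Longrightarrow> ?N y1 \<le> ?N y"
    using continuous_attains_inf[OF K ne cont] by blast
  obtain y2 where y2: "y2 \<in> ?K" "\<And>y. y \<in> ?K \<Longrightarrow> ?N y \<le> ?N y2"
    using continuous_attains_sup[OF K ne cont] by blast
  have pos: "0 < ?N y" if y: "y \<in> ?K" for y
  proof -
    obtain p v where "y = (p, v)" "p \<in> usphere" "v \<in> tangent_space p" "v \<noteq> 0"
      using y by (cases y) (force simp: tangent_space_def)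
    then show ?thesis using g by (simp add: riemannian_metric_def riem_norm_def)
  qed
  show ?thesis
  proof (rule that)
    show "0 < ?N y1" "0 < ?N y2" using pos y1(1) y2(1) by blast+
    fix p v :: 'a assume p: "p \<in> usphere" and v: "v \<in> tangent_space p"
    show "?N y1 * norm v \<le> riem_norm g p v \<and> riem_norm g p v \<le> ?N y2 * norm v"
    proof (cases "v = 0")
      case True
      then show ?thesis using riem_norm_scaleR[OF g p v, of 0] by simp
    next
      case False
      have "(p, sgn v) \<in> ?K" using p v False by (simp add: tangent_space_def sgn_div_norm)
      then have "?N y1 \<le> riem_norm g p (sgn v)" "riem_norm g p (sgn v) \<le> ?N y2"
        using y1(2) y2(2) by fastforce+
      moreover have "riem_norm g p v = norm v * riem_norm g p (sgn v)"
        using riem_norm_scaleR[OF g p, of "sgn v" "norm v"] v False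
        by (simp add: sgn_div_norm tangent_space_scaleR)
      ultimately show ?thesis by (simp add: mult.commute mult_left_mono)
    qed
  qed
qed

definition curve_length :: "('a::euclidean_space \<Rightarrow> 'a \<Rightarrow> 'a \<Rightarrow> real) \<Rightarrow> (real \<Rightarrow> 'a) \<Rightarrow> real \<Rightarrow> bool" where
  "curve_length g c l \<longleftrightarrow> valid_path c \<and> path_image c \<subseteq> usphere \<and>
     ((\<lambda>t. riem_norm g (c t) (vector_derivative c (at t))) has_integral l) {0..1}"

lemma riem_dist_altdef:
  "riem_dist g p q = Inf {l. \<exists>c. curve_length g c l \<and> pathstart c = p \<and> pathfinish c = q}"
  unfolding riem_dist_def curve_length_def by (rule arg_cong[where f = Inf]) blast

text \<open>
  The velocity is tangent because \<open>c t \<bullet> c t\<close> is constant. At the end points this is known on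
  one side only, while \<open>vector_derivative c (at t)\<close> depends on both sides; they are therefore put into the
  exceptional set.
\<close>

lemma sphere_curve_velocity:
  assumes "valid_path c" "path_image c \<subseteq> usphere"
  obtains S where "finite S" "0 \<in> S" "1 \<in> S"
    "\<And>t. t \<in> {0..1} - S \<Longrightarrow> (c has_vector_derivative vector_derivative c (at t)) (at t)"
    "\<And>t. t \<in> {0..1} - S \<Longrightarrow> c t \<in> usphere"
    "\<And>t. t \<in> {0..1} - S \<Longrightarrow> vector_derivative c (at t) \<in> tangent_space (c t)"
proof -
  obtain S where S: "finite S" "c C1_differentiable_on {0..1} - S"
    using assms(1) by (auto simp: valid_path_def piecewise_C1_differentiable_on_def)
  have der: "(c has_vector_derivative vector_derivative c (at t)) (at t)" if "t \<in> {0..1} - S" for t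
    using S(2) that by (auto simp: C1_differentiable_on_eq vector_derivative_works)
  have sph: "c t \<in> usphere" if "t \<in> {0..1}" for t
    using assms(2) that by (auto simp: path_image_def image_subset_iff)
  have "vector_derivative c (at t) \<in> tangent_space (c t)" if t: "t \<in> {0..1} - insert 0 (insert 1 S)" for t
  proof -
    have "((\<lambda>s. c s \<bullet> c s) has_vector_derivative
            c t \<bullet> vector_derivative c (at t) + vector_derivative c (at t) \<bullet> c t) (at t)"
      using der[of t] t by (intro bounded_bilinear.has_vector_derivative[OF bounded_bilinear_inner]) auto
    then have "((\<lambda>s. c s \<bullet> c s) has_vector_derivative 2 * (c t \<bullet> vector_derivative c (at t))) (at t)"
      by (simp add: inner_commute)
    moreover have "((\<lambda>s. c s \<bullet> c s) has_vector_derivative 0) (at t)"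
    proof (rule has_vector_derivative_transform_within_open[of "\<lambda>s. 1" 0 t "{0<..<1}"])
      show "t \<in> {0<..<1}" using t by auto
      show "1 = c s \<bullet> c s" if "s \<in> {0<..<1}" for s
        using sph[of s] that by (simp add: dot_square_norm)
    qed auto
    ultimately show ?thesis
      by (auto simp: tangent_space_def dest: vector_derivative_unique_at)
  qed
  then show ?thesis
    using S(1) der sph by (intro that[of "insert 0 (insert 1 S)"]) auto
qed

lemma curve_length_ge:
  assumes g: "riemannian_metric g" and len: "curve_length g c l" and "0 < a"
    and a: "\<And>p v. p \<in> usphere \<Longrightarrow> v \<in> tangent_space p \<Longrightarrow> a * norm v \<le> riem_norm g p v"
  shows "a * norm (pathfinish c - pathstart c) \<le> l"
proof -
  have c: "valid_path c" "path_image c \<subseteq> usphere"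
    and l: "((\<lambda>t. riem_norm g (c t) (vector_derivative c (at t))) has_integral l) {0..1}"
    using len by (auto simp: curve_length_def)
  obtain S where S: "finite S" "0 \<in> S" "1 \<in> S"
    "\<And>t. t \<in> {0..1} - S \<Longrightarrow> (c has_vector_derivative vector_derivative c (at t)) (at t)"
    "\<And>t. t \<in> {0..1} - S \<Longrightarrow> c t \<in> usphere"
    "\<And>t. t \<in> {0..1} - S \<Longrightarrow> vector_derivative c (at t) \<in> tangent_space (c t)"
    by (rule sphere_curve_velocity[OF c]) blast
  let ?v = "\<lambda>t. if t \<in> S then 0 else vector_derivative c (at t)"
  let ?h = "\<lambda>t. if t \<in> S then 0 else riem_norm g (c t) (vector_derivative c (at t))"
  have "(?v has_integral (c 1 - c 0)) {0..1}"
    using S c(1)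
    by (intro fundamental_theorem_of_calculus_strong[OF S(1)])
       (auto simp: valid_path_def piecewise_C1_differentiable_on_def)
  then have v: "((\<lambda>t. a *\<^sub>R ?v t) has_integral a *\<^sub>R (c 1 - c 0)) {0..1}"
    by (rule has_integral_cmul)
  have h: "(?h has_integral l) {0..1}"
    by (rule has_integral_spike_finite[OF S(1) _ l]) auto
  have "norm (integral {0..1} (\<lambda>t. a *\<^sub>R ?v t)) \<le> integral {0..1} ?h"
    using v h a S \<open>0 < a\<close>
    by (intro Henstock_Kurzweil_Integration.integral_norm_bound_integral)
       (auto simp: integrable_on_def)
  then show ?thesis
    using integral_unique[OF v] integral_unique[OF h] \<open>0 < a\<close>
    by (simp add: pathfinish_def pathstart_def)
qed

lemma curve_length_reversepath:
  assumes g: "riemannian_metric g" and len: "curve_length g c l"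
  shows "curve_length g (reversepath c) l"
proof -
  have c: "valid_path c" "path_image c \<subseteq> usphere"
    and l: "((\<lambda>t. riem_norm g (c t) (vector_derivative c (at t))) has_integral l) {0..1}"
    using len by (auto simp: curve_length_def)
  obtain S where S: "finite S" "0 \<in> S" "1 \<in> S"
    "\<And>t. t \<in> {0..1} - S \<Longrightarrow> (c has_vector_derivative vector_derivative c (at t)) (at t)"
    "\<And>t. t \<in> {0..1} - S \<Longrightarrow> c t \<in> usphere"
    "\<And>t. t \<in> {0..1} - S \<Longrightarrow> vector_derivative c (at t) \<in> tangent_space (c t)"
    by (rule sphere_curve_velocity[OF c]) blast
  have "((\<lambda>t. riem_norm g (c (1 - t)) (vector_derivative c (at (1 - t)))) has_integral l) {0..1}"
    using has_integral_affinity01[OF l, of "-1" 1] by simp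
  then have "((\<lambda>t. riem_norm g (reversepath c t) (vector_derivative (reversepath c) (at t))) has_integral l) {0..1}"
  proof (rule has_integral_spike_finite[rotated 2])
    show "finite ((\<lambda>t. 1 - t) ` S)" using S by simp
    fix t assume "t \<in> {0..1} - (\<lambda>t. 1 - t) ` S"
    then have t: "1 - t \<in> {0..1} - S" by (force simp: image_iff)
    have "(c \<circ> (\<lambda>t. 1 - t) has_vector_derivative (- 1) *\<^sub>R vector_derivative c (at (1 - t))) (at t)"
      by (rule vector_diff_chain_at) (auto intro!: derivative_eq_intros S(4)[OF t])
    then have "vector_derivative (reversepath c) (at t) = (- 1) *\<^sub>R vector_derivative c (at (1 - t))"
      by (intro vector_derivative_at) (simp add: reversepath_def o_def)
    then show "riem_norm g (reversepath c t) (vector_derivative (reversepath c) (at t))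
        = riem_norm g (c (1 - t)) (vector_derivative c (at (1 - t)))"
      using riem_norm_scaleR[OF g S(5)[OF t] S(6)[OF t], of "-1"] by (simp add: reversepath_def)
  qed
  then show ?thesis using c by (simp add: curve_length_def)
qed

lemma curve_length_join:
  assumes g: "riemannian_metric g" and len1: "curve_length g c1 l1" and len2: "curve_length g c2 l2"
    and join: "pathfinish c1 = pathstart c2"
  shows "curve_length g (c1 +++ c2) (l1 + l2)"
proof -
  let ?n = "\<lambda>c t. riem_norm g (c t) (vector_derivative c (at t))"
  have c1: "valid_path c1" "path_image c1 \<subseteq> usphere" and l1: "(?n c1 has_integral l1) {0..1}"
    using len1 by (auto simp: curve_length_def)
  have c2: "valid_path c2" "path_image c2 \<subseteq> usphere" and l2: "(?n c2 has_integral l2) {0..1}"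
    using len2 by (auto simp: curve_length_def)
  obtain S1 where S1: "finite S1" "0 \<in> S1" "1 \<in> S1"
    "\<And>t. t \<in> {0..1} - S1 \<Longrightarrow> (c1 has_vector_derivative vector_derivative c1 (at t)) (at t)"
    "\<And>t. t \<in> {0..1} - S1 \<Longrightarrow> c1 t \<in> usphere"
    "\<And>t. t \<in> {0..1} - S1 \<Longrightarrow> vector_derivative c1 (at t) \<in> tangent_space (c1 t)"
    by (rule sphere_curve_velocity[OF c1]) blast
  obtain S2 where S2: "finite S2" "0 \<in> S2" "1 \<in> S2"
    "\<And>t. t \<in> {0..1} - S2 \<Longrightarrow> (c2 has_vector_derivative vector_derivative c2 (at t)) (at t)"
    "\<And>t. t \<in> {0..1} - S2 \<Longrightarrow> c2 t \<in> usphere"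
    "\<And>t. t \<in> {0..1} - S2 \<Longrightarrow> vector_derivative c2 (at t) \<in> tangent_space (c2 t)"
    by (rule sphere_curve_velocity[OF c2]) blast
  have i1: "((\<lambda>t. 2 * ?n c1 (2 * t)) has_integral l1) {0..1/2}"
    and i2: "((\<lambda>t. 2 * ?n c2 (2 * t - 1)) has_integral l2) {1/2..1}"
    using has_integral_affinity01 [OF l1, where m= 2 and c=0, THEN has_integral_cmul [where c=2]]
          has_integral_affinity01 [OF l2, where m= 2 and c="-1", THEN has_integral_cmul [where c=2]]
    by (simp_all only: image_affinity_atLeastAtMost_div_diff, simp_all add: scaleR_conv_of_real mult_ac)
  have "(?n (c1 +++ c2) has_integral l1) {0..1/2}"
  proof (rule has_integral_spike_finite[OF _ _ i1])
    show "finite ((\<lambda>s. s / 2) ` S1)" using S1 by simp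
    fix t :: real assume "t \<in> {0..1/2} - (\<lambda>s. s / 2) ` S1"
    then have t: "2 * t \<in> {0..1} - S1" by (auto simp: image_iff mult.commute dest: bspec[of _ _ "2 * t"])
    have t': "t < 1/2" using t S1(3) by (cases "t = 1/2") auto
    have "(c1 \<circ> (\<lambda>t. 2 * t) has_vector_derivative 2 *\<^sub>R vector_derivative c1 (at (2 * t))) (at t)"
      by (rule vector_diff_chain_at) (auto intro!: derivative_eq_intros S1(4)[OF t])
    then have "(c1 +++ c2 has_vector_derivative 2 *\<^sub>R vector_derivative c1 (at (2 * t))) (at t)"
      by (rule has_vector_derivative_transform_within_open[of _ _ _ "{..<1/2}"])
         (use t' in \<open>auto simp: joinpaths_def\<close>)
    then have "vector_derivative (c1 +++ c2) (at t) = 2 *\<^sub>R vector_derivative c1 (at (2 * t))"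
      by (rule vector_derivative_at)
    then show "?n (c1 +++ c2) t = 2 * ?n c1 (2 * t)"
      using riem_norm_scaleR[OF g S1(5)[OF t] S1(6)[OF t], of 2] t' by (simp add: joinpaths_def)
  qed
  moreover have "(?n (c1 +++ c2) has_integral l2) {1/2..1}"
  proof (rule has_integral_spike_finite[OF _ _ i2])
    show "finite ((\<lambda>s. (s + 1) / 2) ` S2)" using S2 by simp
    fix t :: real assume "t \<in> {1/2..1} - (\<lambda>s. (s + 1) / 2) ` S2"
    then have t: "2 * t - 1 \<in> {0..1} - S2" by (auto simp: image_iff mult.commute dest: bspec[of _ _ "2 * t - 1"])
    have t': "t > 1/2" using t S2(2) by (cases "t = 1/2") auto
    have "(c2 \<circ> (\<lambda>t. 2 * t - 1) has_vector_derivative 2 *\<^sub>R vector_derivative c2 (at (2 * t - 1))) (at t)"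
      by (rule vector_diff_chain_at) (auto intro!: derivative_eq_intros S2(4)[OF t])
    then have "(c1 +++ c2 has_vector_derivative 2 *\<^sub>R vector_derivative c2 (at (2 * t - 1))) (at t)"
      by (rule has_vector_derivative_transform_within_open[of _ _ _ "{1/2<..}"])
         (use t' in \<open>auto simp: joinpaths_def\<close>)
    then have "vector_derivative (c1 +++ c2) (at t) = 2 *\<^sub>R vector_derivative c2 (at (2 * t - 1))"
      by (rule vector_derivative_at)
    then show "?n (c1 +++ c2) t = 2 * ?n c2 (2 * t - 1)"
      using riem_norm_scaleR[OF g S2(5)[OF t] S2(6)[OF t], of 2] t' by (simp add: joinpaths_def)
  qed
  ultimately have "(?n (c1 +++ c2) has_integral (l1 + l2)) {0..1}"
    by (rule has_integral_combine[rotated 2]) auto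
  then show ?thesis
    using c1 c2 join path_image_join_subset[of c1 c2] valid_path_join[of c1 c2]
    by (auto simp: curve_length_def)
qed

text \<open>
  The vector \<open>e\<close> is the direction at \<open>p\<close> of the great circle to \<open>q\<close>. If \<open>q\<close> is \<open>p\<close> or its antipode, then any
  direction will do; one exists since the sphere has positive dimension.
\<close>

lemma great_circle_decomposition:
  fixes p q :: "'a::euclidean_space"
  assumes "p \<in> usphere" "q \<in> usphere" and dim: "2 \<le> DIM('a)"
  obtains e where "e \<in> usphere" "p \<bullet> e = 0"
    "q = cos (arccos (p \<bullet> q)) *\<^sub>R p + sin (arccos (p \<bullet> q)) *\<^sub>R e"
proof -
  have pq: "\<bar>p \<bullet> q\<bar> \<le> 1" using Cauchy_Schwarz_ineq2[of p q] assms by simp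
  then have cs: "cos (arccos (p \<bullet> q)) = p \<bullet> q" "sin (arccos (p \<bullet> q)) = sqrt (1 - (p \<bullet> q)\<^sup>2)"
    by (auto simp: abs_le_iff sin_arccos_abs)
  let ?w = "q - (p \<bullet> q) *\<^sub>R p"
  have pw: "p \<bullet> ?w = 0" using assms(1) by (simp add: inner_diff_right dot_square_norm)
  have "?w \<bullet> ?w = 1 - (p \<bullet> q)\<^sup>2"
    using assms(1,2) by (simp add: inner_diff_left inner_diff_right norm_eq_1 inner_commute[of q p] power2_eq_square)
  then have nw: "norm ?w = sqrt (1 - (p \<bullet> q)\<^sup>2)" by (simp add: norm_eq_sqrt_inner)
  show ?thesis
  proof (cases "?w = 0")
    case True
    obtain v where v: "v \<noteq> 0" "orthogonal p v" using orthogonal_to_vector_exists[OF dim] by blast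
    show ?thesis
      by (rule that[of "sgn v"]) (use v True nw in \<open>auto simp: cs orthogonal_def sgn_div_norm\<close>)
  next
    case False
    show ?thesis
    proof (rule that[of "sgn ?w"])
      show "sgn ?w \<in> usphere" using False by (simp add: norm_sgn)
      show "p \<bullet> sgn ?w = 0" using pw by (simp add: sgn_div_norm)
      have "norm ?w *\<^sub>R sgn ?w = ?w" using False by (simp add: sgn_div_norm)
      then show "q = cos (arccos (p \<bullet> q)) *\<^sub>R p + sin (arccos (p \<bullet> q)) *\<^sub>R sgn ?w"
        unfolding cs nw[symmetric] by simp
    qed
  qed
qed

lemma great_circle_length:
  assumes g: "riemannian_metric g" and p: "p \<in> usphere" and e: "e \<in> usphere" "p \<bullet> e = 0" and "0 \<le> \<theta>" "0 \<le> b"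
    and b: "\<And>p v. p \<in> usphere \<Longrightarrow> v \<in> tangent_space p \<Longrightarrow> riem_norm g p v \<le> b * norm v"
  obtains c l where "curve_length g c l" "pathstart c = p"
    "pathfinish c = cos \<theta> *\<^sub>R p + sin \<theta> *\<^sub>R e" "l \<le> b * \<theta>"
proof -
  define c where "c = (\<lambda>t. cos (\<theta> * t) *\<^sub>R p + sin (\<theta> * t) *\<^sub>R e)"
  define c' where "c' = (\<lambda>t. \<theta> *\<^sub>R (- sin (\<theta> * t) *\<^sub>R p + cos (\<theta> * t) *\<^sub>R e))"
  have der: "(c has_vector_derivative c' t) (at t)" for t
    unfolding c_def c'_def
    by (auto intro!: derivative_eq_intros simp: algebra_simps scaleR_add_right)
  have der': "vector_derivative c (at t) = c' t" for t by (rule vector_derivative_at[OF der])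
  have contc: "continuous_on A c" "continuous_on A c'" for A
    unfolding c_def c'_def by (intro continuous_intros)+
  have dots: "p \<bullet> p = 1" "e \<bullet> e = 1" "e \<bullet> p = 0" using p e by (auto simp: dot_square_norm inner_commute)
  have "c t \<bullet> c t = (cos (\<theta> * t))\<^sup>2 + (sin (\<theta> * t))\<^sup>2" for t
    by (simp add: c_def inner_add_left inner_add_right dots e power2_eq_square)
  then have sph: "c t \<in> usphere" for t by (simp add: norm_eq_sqrt_inner)
  have tan: "c' t \<in> tangent_space (c t)" for t
    by (simp add: tangent_space_def c_def c'_def inner_add_left inner_add_right inner_diff_right dots e algebra_simps)
  let ?u = "\<lambda>t. - sin (\<theta> * t) *\<^sub>R p + cos (\<theta> * t) *\<^sub>R e"
  have "?u t \<bullet> ?u t = 1" for t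
    using sin_cos_squared_add[of "\<theta> * t"]
    by (simp add: inner_add_left inner_add_right inner_diff_right inner_diff_left dots e power2_eq_square)
  then have "norm (?u t) = 1" for t by (simp only: norm_eq_sqrt_inner real_sqrt_one)
  then have nc': "norm (c' t) = \<theta>" for t using \<open>0 \<le> \<theta>\<close> by (simp add: c'_def)
  have "continuous_on {0..1} (\<lambda>t. (\<lambda>(p, v). metric_ext g p v v) (c t, c' t))"
    by (rule continuous_on_compose2[OF continuous_on_metric_ext[OF g] continuous_on_Pair[OF contc]])
       (use sph in auto)
  then have "continuous_on {0..1} (\<lambda>t. riem_norm g (c t) (c' t))"
    using metric_ext_tangent[OF sph tan tan] by (simp add: riem_norm_def continuous_on_real_sqrt)
  then obtain l where l: "((\<lambda>t. riem_norm g (c t) (c' t)) has_integral l) {0..1}"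
    using integrable_continuous_interval unfolding integrable_on_def by blast
  have "l \<le> b * \<theta>"
  proof (rule has_integral_le[OF l])
    show "((\<lambda>t::real. b * \<theta>) has_integral b * \<theta>) {0..1}" using has_integral_const_real[of "b * \<theta>" 0 1] by simp
    show "riem_norm g (c t) (c' t) \<le> b * \<theta>" for t using b[OF sph tan, of t] by (simp add: nc')
  qed
  moreover have "valid_path c"
    unfolding valid_path_def
    by (intro C1_differentiable_imp_piecewise) (use der contc in \<open>auto simp: C1_differentiable_on_def\<close>)
  then have "curve_length g c l" using l sph by (auto simp: curve_length_def der' path_image_def)
  ultimately show ?thesis
    by (intro that[of c l]) (auto simp: c_def pathstart_def pathfinish_def)
qed

text \<open>
  The infimum in \<open>riem_dist\<close> is over a nonempty set because any two points are joined by a great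
  circle, and it is over a set of lengths bounded below by the Euclidean distance up to a factor, which
  gives positivity. The number \<open>arccos (p \<bullet> q)\<close> is the angle between \<open>p\<close> and \<open>q\<close>; it tends to \<open>0\<close> as
  \<open>q\<close> tends to \<open>p\<close>, so the two bounds make \<open>riem_dist g\<close> induce the Euclidean topology.
\<close>

lemma riem_dist_metric:
  fixes g :: "'a::euclidean_space \<Rightarrow> 'a \<Rightarrow> 'a \<Rightarrow> real"
  assumes g: "riemannian_metric g" and dim: "2 \<le> DIM('a)"
  obtains a b where "0 < a" "0 < b"
    "\<And>p q. p \<in> usphere \<Longrightarrow> q \<in> usphere \<Longrightarrow> a * norm (p - q) \<le> riem_dist g p q"
    "\<And>p q. p \<in> usphere \<Longrightarrow> q \<in> usphere \<Longrightarrow> riem_dist g p q \<le> b * arccos (p \<bullet> q)"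
    "\<And>p q. p \<in> usphere \<Longrightarrow> q \<in> usphere \<Longrightarrow> riem_dist g p q = riem_dist g q p"
    "\<And>p q z. p \<in> usphere \<Longrightarrow> q \<in> usphere \<Longrightarrow> z \<in> usphere \<Longrightarrow> riem_dist g p z \<le> riem_dist g p q + riem_dist g q z"
proof -
  obtain a b where ab: "0 < a" "0 < b"
    "\<And>p v. p \<in> usphere \<Longrightarrow> v \<in> tangent_space p \<Longrightarrow> a * norm v \<le> riem_norm g p v \<and> riem_norm g p v \<le> b * norm v"
    using riem_norm_equivalent[OF g dim] by metis
  let ?L = "\<lambda>p q. {l. \<exists>c. curve_length g c l \<and> pathstart c = p \<and> pathfinish c = q}"
  have lower: "a * norm (p - q) \<le> l" if "l \<in> ?L p q" for p q l
    using that curve_length_ge[OF g _ ab(1)] ab(3) by (auto simp: norm_minus_commute)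
  have bdd: "bdd_below (?L p q)" for p q using lower by (rule bdd_belowI)
  have curve: "\<exists>l \<in> ?L p q. l \<le> b * arccos (p \<bullet> q)" if pq: "p \<in> usphere" "q \<in> usphere" for p q
  proof -
    obtain e where e: "e \<in> usphere" "p \<bullet> e = 0"
      "q = cos (arccos (p \<bullet> q)) *\<^sub>R p + sin (arccos (p \<bullet> q)) *\<^sub>R e"
      using great_circle_decomposition[OF pq dim] by blast
    have "\<bar>p \<bullet> q\<bar> \<le> 1" using Cauchy_Schwarz_ineq2[of p q] pq by simp
    then have "0 \<le> arccos (p \<bullet> q)" by (intro arccos_lbound) auto
    then obtain c l where "curve_length g c l" "pathstart c = p"
      "pathfinish c = cos (arccos (p \<bullet> q)) *\<^sub>R p + sin (arccos (p \<bullet> q)) *\<^sub>R e" "l \<le> b * arccos (p \<bullet> q)"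
      using great_circle_length[OF g pq(1) e(1,2), of "arccos (p \<bullet> q)" b] ab by (metis less_imp_le)
    then show ?thesis using e(3) by auto
  qed
  have ne: "?L p q \<noteq> {}" if "p \<in> usphere" "q \<in> usphere" for p q using curve[OF that] by blast
  have sym: "?L p q \<subseteq> ?L q p" for p q
  proof
    fix l assume "l \<in> ?L p q"
    then obtain c where "curve_length g c l" "pathstart c = p" "pathfinish c = q" by blast
    then have "curve_length g (reversepath c) l \<and> pathstart (reversepath c) = q \<and> pathfinish (reversepath c) = p"
      using curve_length_reversepath[OF g] by simp
    then show "l \<in> ?L q p" by blast
  qed
  show ?thesis
  proof (rule that[OF ab(1,2)])
    fix p q :: 'a assume pq: "p \<in> usphere" "q \<in> usphere"
    show "a * norm (p - q) \<le> riem_dist g p q"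
      unfolding riem_dist_altdef by (rule cInf_greatest[OF ne[OF pq] lower])
    obtain l where "l \<in> ?L p q" "l \<le> b * arccos (p \<bullet> q)" using curve[OF pq] by blast
    then show "riem_dist g p q \<le> b * arccos (p \<bullet> q)"
      unfolding riem_dist_altdef by (blast intro: order_trans[OF cInf_lower[OF _ bdd]])
    show "riem_dist g p q = riem_dist g q p"
      unfolding riem_dist_altdef by (rule arg_cong[where f = Inf]) (rule subset_antisym[OF sym sym])
    fix z :: 'a assume z: "z \<in> usphere"
    have "riem_dist g p z \<le> l1 + l2" if l: "l1 \<in> ?L p q" "l2 \<in> ?L q z" for l1 l2
    proof -
      obtain c1 c2 where "curve_length g c1 l1" "pathstart c1 = p" "pathfinish c1 = q"
        "curve_length g c2 l2" "pathstart c2 = q" "pathfinish c2 = z"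
        using l by blast
      then have "curve_length g (c1 +++ c2) (l1 + l2) \<and> pathstart (c1 +++ c2) = p \<and> pathfinish (c1 +++ c2) = z"
        using curve_length_join[OF g] by simp
      then have "l1 + l2 \<in> ?L p z" by blast
      then show ?thesis unfolding riem_dist_altdef by (rule cInf_lower[OF _ bdd])
    qed
    then have "riem_dist g p z - l2 \<le> riem_dist g p q" if "l2 \<in> ?L q z" for l2
      unfolding riem_dist_altdef[of g p q] using that
      by (intro cInf_greatest[OF ne[OF pq]]) (auto simp: algebra_simps)
    then have "riem_dist g p z - riem_dist g p q \<le> riem_dist g q z"
      unfolding riem_dist_altdef[of g q z]
      by (intro cInf_greatest[OF ne[OF pq(2) z]]) (auto simp: algebra_simps)
    then show "riem_dist g p z \<le> riem_dist g p q + riem_dist g q z" by simp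
  qed
qed

lemma tendsto_dist_of_arccos_bound:
  fixes X :: "nat \<Rightarrow> 'a::euclidean_space"
  assumes X: "\<And>n. X n \<in> usphere" and l: "l \<in> usphere" and lim: "X \<longlonglongrightarrow> l" and b: "0 < b"
    and upper: "\<And>p q. p \<in> usphere \<Longrightarrow> q \<in> usphere \<Longrightarrow> d p q \<le> b * arccos (p \<bullet> q)"
    and nonneg: "\<And>p q. p \<in> usphere \<Longrightarrow> q \<in> usphere \<Longrightarrow> 0 \<le> d p q"
  shows "(\<lambda>n. d (X n) l) \<longlonglongrightarrow> 0"
proof -
  have "\<bar>X n \<bullet> l\<bar> \<le> 1" for n using Cauchy_Schwarz_ineq2[of "X n" l] X[of n] l by simp
  then have range: "X n \<bullet> l \<in> {-1..1}" for n by (simp add: abs_le_iff)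
  have "(\<lambda>n. X n \<bullet> l) \<longlonglongrightarrow> l \<bullet> l" by (intro tendsto_intros lim)
  then have "(\<lambda>n. X n \<bullet> l) \<longlonglongrightarrow> 1" using l by (simp add: dot_square_norm)
  then have "(\<lambda>n. arccos (X n \<bullet> l)) \<longlonglongrightarrow> arccos 1"
    by (rule continuous_on_tendsto_compose[OF continuous_on_arccos']) (use range in auto)
  then have "(\<lambda>n. b * arccos (X n \<bullet> l)) \<longlonglongrightarrow> 0"
    using tendsto_mult_right_zero by simp
  then show ?thesis
    by (rule tendsto_sandwich[OF _ _ tendsto_const, rotated 2];
        intro always_eventually allI upper nonneg X l)
qed

lemma nearby_point_on_sphere:
  fixes p :: "'a::euclidean_space"
  assumes p: "p \<in> usphere" and dim: "2 \<le> DIM('a)" and b: "0 < b"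
    and upper: "\<And>p q. p \<in> usphere \<Longrightarrow> q \<in> usphere \<Longrightarrow> d p q \<le> b * arccos (p \<bullet> q)" and "0 < \<epsilon>"
  obtains q where "q \<in> usphere" "q \<noteq> p" "d p q \<le> \<epsilon>"
proof -
  obtain v where v: "v \<noteq> 0" "orthogonal p v" using orthogonal_to_vector_exists[OF dim] by blast
  define e where "e = sgn v"
  have e: "e \<bullet> e = 1" "p \<bullet> e = 0" "e \<bullet> p = 0" "p \<bullet> p = 1"
    using v p by (auto simp: e_def norm_sgn orthogonal_def sgn_div_norm dot_square_norm inner_commute)
  define \<theta> where "\<theta> = min (pi / 2) (\<epsilon> / b)"
  have \<theta>: "0 < \<theta>" "\<theta> \<le> pi / 2" "b * \<theta> \<le> \<epsilon>"
    using assms(5) b by (auto simp: \<theta>_def min_def field_simps)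
  define q where "q = cos \<theta> *\<^sub>R p + sin \<theta> *\<^sub>R e"
  have "q \<bullet> q = 1" using sin_cos_squared_add[of \<theta>]
    by (simp add: q_def inner_add_left inner_add_right e power2_eq_square)
  then have q: "q \<in> usphere" by (simp add: norm_eq_1)
  have "e \<bullet> q = sin \<theta>" by (simp add: q_def inner_add_right e)
  moreover have "0 < sin \<theta>" using \<theta> by (intro sin_gt_zero) auto
  ultimately have "q \<noteq> p" using e by auto
  moreover have "p \<bullet> q = cos \<theta>" by (simp add: q_def inner_add_right e)
  then have "d p q \<le> \<epsilon>" using upper[OF p q] \<theta> by (simp add: arccos_cos)
  ultimately show ?thesis using q that by blast
qed

section \<open>North-south diffeomorphisms\<close>

theorem proposition5p20:
  fixes k :: nat
    and f :: "'a::euclidean_space \<Rightarrow> 'a" and N S :: 'a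
    and g :: "'a \<Rightarrow> 'a \<Rightarrow> 'a \<Rightarrow> real"
    and r lam L \<mu> \<rho> \<gamma> c \<delta> :: real
    and \<phi> :: "'a \<Rightarrow> real"
    and u m :: nat
  defines "d \<equiv> riem_dist g"
    and "f_inv \<equiv> inv_into usphere f"
    and "B \<equiv> riem_ball g"
    and "U \<equiv> {p \<in> usphere. riem_dist g p N > r - \<gamma> \<and> riem_dist g p S > r - \<gamma>}"
    and "br \<equiv> bracket g \<phi> \<rho>"
  assumes dim: "k \<ge> 1" "DIM('a) = k + 1"
    and ns: "north_south f N S"
    and metric: "riemannian_metric g"
    and mu: "0 < \<mu>" "\<mu> < 1"
    and r: "r > 0" "closure (B N r) \<inter> closure (B S r) = {}"
    and lam: "0 < lam" "lam < 1"
    and contr_S: "\<And>p q n. p \<in> B S r \<Longrightarrow> q \<in> B S r \<Longrightarrow>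
                    d ((f ^^ n) p) ((f ^^ n) q) \<le> lam ^ n * d p q"
    and contr_N: "\<And>p q n. p \<in> B N r \<Longrightarrow> q \<in> B N r \<Longrightarrow>
                    d ((f_inv ^^ n) p) ((f_inv ^^ n) q) \<le> lam ^ n * d p q"
    and lipschitz: "\<And>p q. p \<in> usphere \<Longrightarrow> q \<in> usphere \<Longrightarrow>
                      d (f p) (f q) \<le> L * d p q \<and> d (f_inv p) (f_inv q) \<le> L * d p q"
    and phi: "continuous_on usphere \<phi>" "\<phi> ` usphere \<subseteq> {0..1}"
             "\<And>p. p \<in> B N r \<Longrightarrow> \<phi> p = 1" "\<And>p. p \<in> B S r \<Longrightarrow> \<phi> p = 0"
    and rho: "\<rho> > 0"
             "\<And>p. p \<in> usphere \<Longrightarrow>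
                bij_betw (riem_exp g p) (tangent_disc g \<rho> p) {q \<in> usphere. d p q \<le> \<rho>}"
    and gamma: "0 < \<gamma>" "\<gamma> < min r \<rho>"
               "\<And>p q. p \<in> U \<Longrightarrow> q \<in> U \<Longrightarrow> d p q \<le> \<gamma> \<Longrightarrow>
                  geodesic_segment g \<rho> p q \<inter> (B N (r / 2) \<union> B S (r / 2)) = {}"
    and u: "u \<ge> 1"
           "\<And>p q i. p \<in> U \<Longrightarrow> q \<in> U \<Longrightarrow> d p q \<le> \<gamma> \<Longrightarrow> \<bar>i\<bar> \<ge> int u \<Longrightarrow>
              zpow usphere f i ` {p, q, br p q} \<subseteq> B N (r / 2) \<union> B S (r / 2)"
           "(f ^^ u) ` B N r \<union> (f_inv ^^ u) ` B S r = usphere"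
    and c: "c = L ^ u / lam ^ u"
    and hyperbolic: "hyperbolic_bracket usphere d f \<gamma> c lam br"
    and m: "m \<ge> 1" "c * lam ^ m \<le> 1 / (2 * c)"
    and delta: "\<delta> > 0" "2 * \<delta> * (\<Sum>j<m. L ^ j) \<le> \<gamma>"
               "shadow_brackets_defined usphere d f \<delta> \<gamma> m br"
  shows "self_tuning usphere d \<mu> f \<delta> (shadow_map usphere f m br) \<and>
         \<not> shift_invariant usphere d f \<delta> (shadow_map usphere f m br)"
proof -
  have dim2: "2 \<le> DIM('a)" using dim by simp
  obtain a b where ab: "0 < a" "0 < b"
    and lower: "\<And>p q. p \<in> usphere \<Longrightarrow> q \<in> usphere \<Longrightarrow> a * norm (p - q) \<le> d p q"
    and upper: "\<And>p q. p \<in> usphere \<Longrightarrow> q \<in> usphere \<Longrightarrow> d p q \<le> b * arccos (p \<bullet> q)"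
    and commute: "\<And>p q. p \<in> usphere \<Longrightarrow> q \<in> usphere \<Longrightarrow> d p q = d q p"
    and triangle: "\<And>p q z. p \<in> usphere \<Longrightarrow> q \<in> usphere \<Longrightarrow> z \<in> usphere \<Longrightarrow> d p z \<le> d p q + d q z"
    unfolding d_def by (rule riem_dist_metric[OF metric dim2]) blast
  have nonneg: "0 \<le> d p q" if "p \<in> usphere" "q \<in> usphere" for p q
    by (rule order_trans[OF _ lower[OF that]]) (use ab in simp)
  have eq_if_le_0: "p = q" if "p \<in> usphere" "q \<in> usphere" "d p q \<le> 0" for p q
  proof (rule ccontr)
    assume "p \<noteq> q"
    then have "0 < a * norm (p - q)" using ab by simp
    then show False using lower[OF that(1,2)] that(3) by linarith
  qed
  have refl: "d p p = 0" if "p \<in> usphere" for p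
    using upper[OF that that] nonneg[OF that that] that by (simp add: dot_square_norm)
  have conv: "(\<lambda>n. d (X n) l) \<longlonglongrightarrow> 0" if X: "\<And>n. X n \<in> usphere" "l \<in> usphere" "X \<longlonglongrightarrow> l" for X l
    using tendsto_dist_of_arccos_bound[OF X ab(2) upper nonneg] .

  have sd: "sphere_diffeo f" and NS: "N \<noteq> S" and N: "N \<in> usphere" "f N = N" and S: "S \<in> usphere" "f S = S"
    using ns by (simp_all add: north_south_def hyperbolic_fixed_point_def)
  have toS: "\<And>p. p \<in> usphere \<Longrightarrow> p \<noteq> N \<Longrightarrow> p \<noteq> S \<Longrightarrow> (\<lambda>n. (f ^^ n) p) \<longlonglongrightarrow> S"
    and toN: "\<And>p. p \<in> usphere \<Longrightarrow> p \<noteq> N \<Longrightarrow> p \<noteq> S \<Longrightarrow> (\<lambda>n. (f_inv ^^ n) p) \<longlonglongrightarrow> N"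
    using ns unfolding north_south_def f_inv_def by simp_all
  have f_inv: "f_inv = inv_into usphere f" by (simp add: f_inv_def)
  interpret inv: inverse_pair usphere f f_inv
    unfolding f_inv_def by (rule inverse_pair_inv_into) (use sd in \<open>simp add: sphere_diffeo_def\<close>)

  \<comment> \<open>\<open>N\<close> and \<open>S\<close> are distinct fixed points, so \<open>f\<close> cannot contract\<close>
  have L1: "1 \<le> L"
  proof -
    have "0 < d N S" using eq_if_le_0[OF N(1) S(1)] NS by linarith
    moreover have "1 * d N S \<le> L * d N S" using lipschitz[OF N(1) S(1)] N(2) S(2) by simp
    ultimately show ?thesis by (rule mult_right_le_imp_le[rotated])
  qed
  have Lu: "1 \<le> L ^ u" using L1 by (rule one_le_power)
  have lamu: "0 < lam ^ u" "lam ^ u \<le> 1" using lam by (auto intro: power_le_one)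
  have c1: "1 \<le> c" unfolding c using Lu lamu by (simp add: field_simps)
  have m_half: "c * lam ^ m \<le> 1 / 2"
    by (rule order_trans[OF m(2)]) (use c1 in \<open>simp add: field_simps\<close>)

  have bracket: "br p q \<in> usphere"
      "d ((f ^^ n) (br p q)) ((f ^^ n) q) \<le> c * lam ^ n * d p q"
      "d ((f_inv ^^ n) (br p q)) ((f_inv ^^ n) p) \<le> c * lam ^ n * d p q"
    if "p \<in> usphere" "q \<in> usphere" "d p q \<le> \<gamma>" for p q n
    using bspec[OF hyperbolic[unfolded hyperbolic_bracket_def], of "(p, q)"] that
    by (auto simp: close_pairs_def f_inv_def)

  have lip: "d (f p) (f q) \<le> L * d p q" "d (f_inv p) (f_inv q) \<le> L * d p q"
    if "p \<in> usphere" "q \<in> usphere" for p q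
    using lipschitz[OF that] by simp_all

  interpret hyp: hyperbolic_system usphere f f_inv d br L lam c \<gamma> m
  proof unfold_locales
    fix X :: "nat \<Rightarrow> 'a"
    assume X: "\<And>n. X n \<in> usphere" and cauchy: "\<And>e. e > 0 \<Longrightarrow> \<exists>N. \<forall>n\<ge>N. \<forall>k. d (X (n + k)) (X n) < e"
    have "Cauchy X"
    proof (rule CauchyI')
      fix e :: real assume "0 < e"
      then have "0 < a * e" using ab by simp
      from cauchy[OF this] obtain n0 where n0: "\<forall>n\<ge>n0. \<forall>k. d (X (n + k)) (X n) < a * e" by blast
      have "dist (X n) (X j) < e" if "n \<ge> n0" "j > n" for j n
      proof -
        have "n + (j - n) = j" using that(2) by simp
        then have "d (X j) (X n) < a * e" using n0[rule_format, OF that(1), of "j - n"] by simp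
        then have "a * norm (X j - X n) < a * e"
          by (rule le_less_trans[OF lower[OF X X]])
        then show ?thesis using ab by (simp add: dist_norm norm_minus_commute)
      qed
      then show "\<exists>M. \<forall>m\<ge>M. \<forall>n>m. dist (X m) (X n) < e" by blast
    qed
    then obtain l where l: "X \<longlonglongrightarrow> l" using Cauchy_convergent convergent_def by blast
    have "l \<in> usphere" by (rule closed_sequentially[OF closed_sphere X l])
    then show "\<exists>l\<in>usphere. X \<longlonglongrightarrow> l \<and> (\<lambda>n. d (X n) l) \<longlonglongrightarrow> 0" using conv[OF X _ l] l by blast
  qed (fact nonneg commute triangle refl lip L1 lam c1 m(1) m_half
       gamma(1) bracket)+

  have "self_tuning usphere d \<mu> f \<delta> (shadow_map usphere f m br)"
  proof (rule hyp.self_tuning_shadow_map[OF f_inv mu _ delta(3)])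
    fix p q :: 'a assume pq: "p \<in> usphere" "q \<in> usphere"
    have "\<bar>p \<bullet> q\<bar> \<le> 1" using Cauchy_Schwarz_ineq2[of p q] pq by simp
    then have "arccos (p \<bullet> q) \<le> pi" by (intro arccos_ubound) auto
    then show "d p q \<le> b * pi" using upper[OF pq] ab(2) by (meson mult_left_mono less_imp_le order_trans)
  qed

  moreover have "\<not> shift_invariant usphere d f \<delta> (shadow_map usphere f m br)"
  proof
    have ball: "p \<in> B z r \<longleftrightarrow> p \<in> usphere \<and> d p z < r" for p z by (simp add: B_def riem_ball_def d_def)
    have ev_ball: "\<exists>n. X n \<in> B l r" if X: "\<And>n. X n \<in> usphere" "l \<in> usphere" "X \<longlonglongrightarrow> l" for X l
    proof -
      have "eventually (\<lambda>n. d (X n) l < r) sequentially"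
        using order_tendstoD(2)[OF conv[OF X] r(1)] .
      then show ?thesis using X(1) by (auto simp: ball eventually_sequentially)
    qed
    have disj: "B N r \<inter> B S r = {}" using r(2) closure_subset by blast
    have invN: "(f_inv ^^ n) p \<in> B N r" if "p \<in> B N r" for p n
    proof -
      have "f_inv N = N" using inv.F'_F[OF N(1)] N(2) by simp
      then have "(f_inv ^^ n) N = N" by (induction n) auto
      moreover have "N \<in> B N r" using N refl r(1) by (simp add: ball)
      ultimately have "d ((f_inv ^^ n) p) N \<le> lam ^ n * d p N" using contr_N[OF that, of N n] by simp
      also have "\<dots> \<le> d p N" using that N nonneg lam by (intro mult_left_le_one_le power_le_one) (auto simp: ball)
      finally show ?thesis using that inv.F'n_in by (auto simp: ball)
    qed
    have invS: "(f ^^ n) p \<in> B S r" if "p \<in> B S r" for p n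
    proof -
      have "(f ^^ n) S = S" using S(2) by (induction n) auto
      moreover have "S \<in> B S r" using S refl r(1) by (simp add: ball)
      ultimately have "d ((f ^^ n) p) S \<le> lam ^ n * d p S" using contr_S[OF that, of S n] by simp
      also have "\<dots> \<le> d p S" using that S nonneg lam by (intro mult_left_le_one_le power_le_one) (auto simp: ball)
      finally show ?thesis using that inv.Fn_in by (auto simp: ball)
    qed

    \<comment> \<open>hyperbolicity with \<open>p = q\<close> and \<open>n = 0\<close>\<close>
    have idem: "br z z = z" if z: "z \<in> usphere" for z
    proof (rule eq_if_le_0[OF _ z])
      have "d z z \<le> \<gamma>" using refl[OF z] gamma(1) by simp
      then show "br z z \<in> usphere" "d (br z z) z \<le> 0"
        using bracket(1)[OF z z] bracket(2)[OF z z, of 0] refl[OF z] by simp_all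
    qed
    \<comment> \<open>where \<open>\<phi> = 1\<close> the bracket goes all the way along the geodesic to \<open>w\<close>\<close>
    have br_N: "br v w = w" if "v \<in> B N r" "(v, w) \<in> close_pairs usphere d \<gamma>" for v w
    proof -
      have vw: "v \<in> usphere" "w \<in> usphere" "d v w \<le> \<rho>" using that(2) gamma(2) by (auto simp: close_pairs_def)
      then have "riem_exp g v (riem_log g \<rho> v w) = w"
        unfolding riem_log_def using bij_betw_inv_into_right[OF rho(2)[OF vw(1)]] by blast
      then show ?thesis using phi(3)[OF that(1)] by (simp add: br_def bracket_def)
    qed
    \<comment> \<open>where \<open>\<phi> = 0\<close> the bracket ignores its second argument, so \<open>idem\<close> determines it\<close>
    have br_S: "br v w = v" if "v \<in> B S r" for v w
    proof -
      have "br v w = br v v" using phi(4)[OF that] by (simp add: br_def bracket_def)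
      also have "\<dots> = v" using that by (intro idem) (simp add: ball)
      finally show ?thesis .
    qed

    obtain z where z: "z \<in> usphere" "z \<noteq> N" "z \<noteq> S"
    proof -
      obtain v where v: "v \<noteq> 0" "orthogonal N v" using orthogonal_to_vector_exists[OF dim2] by blast
      let ?e = "sgn v"
      have e: "?e \<in> usphere" "N \<bullet> ?e = 0" "?e \<bullet> ?e = 1" "N \<bullet> N = 1"
        using v N(1) by (simp_all add: norm_sgn orthogonal_def sgn_div_norm dot_square_norm)
      have "?e \<noteq> N" "- ?e \<noteq> N" using e by auto
      moreover have "?e \<noteq> S \<or> - ?e \<noteq> S"
      proof (rule ccontr)
        assume "\<not> ?thesis"
        then have "?e \<bullet> ?e = - ?e \<bullet> ?e" by simp
        then show False using e by simp
      qed
      ultimately show ?thesis using that[of ?e] that[of "- ?e"] e(1) by auto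
    qed
    obtain i where i: "(f_inv ^^ i) z \<in> B N r"
      using ev_ball[OF inv.F'n_in[OF z(1)] N(1) toN[OF z]] by blast
    obtain j where j: "(f ^^ j) z \<in> B S r"
      using ev_ball[OF inv.Fn_in[OF z(1)] S(1) toS[OF z]] by blast
    define w where "w = (f_inv ^^ i) z"
    have w: "w \<in> usphere" using inv.F'n_in z by (simp add: w_def)
    have "(f ^^ (j + i)) w = (f ^^ j) z" using inv.Fn_F'n[OF z(1)] by (simp add: w_def funpow_add)
    then have ex: "\<exists>n. (f ^^ n) w \<notin> B N r" using j disj by (metis disjoint_iff)
    \<comment> \<open>\<open>p\<close> is the first point of the orbit that has left the ball around \<open>N\<close>\<close>
    define n0 where "n0 = (LEAST n. (f ^^ n) w \<notin> B N r)"
    define p where "p = (f ^^ n0) w"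
    have p_out: "p \<notin> B N r" unfolding p_def n0_def by (rule LeastI_ex[OF ex])
    then obtain n1 where n1: "n0 = Suc n1" using i by (cases n0) (auto simp: p_def w_def)
    have p: "p \<in> usphere" using inv.Fn_in w by (simp add: p_def)
    have "f_inv p = (f ^^ n1) w" using inv.F'_F[OF inv.Fn_in[OF w]] by (simp add: p_def n1)
    moreover have "(f ^^ n1) w \<in> B N r" using not_less_Least[of n1 "\<lambda>n. (f ^^ n) w \<notin> B N r"] n1 n0_def by auto
    ultimately have p_in: "f_inv p \<in> B N r" by simp
    have past: "(f_inv ^^ Suc n) p \<in> B N r" for n
      using invN[OF p_in, of n] by (simp add: funpow_swap1)

    \<comment> \<open>the two images cover the sphere, so \<open>f\<^sup>u(p)\<close> is in the other one and the transit takes at most \<open>2 u\<close> steps\<close>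
    have "(f ^^ u) p \<notin> (f ^^ u) ` B N r"
    proof
      assume "(f ^^ u) p \<in> (f ^^ u) ` B N r"
      then obtain v where v: "v \<in> B N r" "(f ^^ u) p = (f ^^ u) v" by blast
      have "v \<in> usphere" using v(1) by (simp add: ball)
      then have "p = v" using inv.F'n_Fn[OF p, of u] inv.F'n_Fn[of v u] v(2) by metis
      then show False using v(1) p_out by blast
    qed
    then have "(f ^^ u) p \<in> (f_inv ^^ u) ` B S r" using u(3) inv.Fn_in[OF p] by blast
    then obtain s where s: "s \<in> B S r" "(f ^^ u) p = (f_inv ^^ u) s" by blast
    have "s \<in> usphere" using s(1) by (simp add: ball)
    then have "(f ^^ (u + u)) p = s" using s(2) inv.Fn_F'n[of s u] by (simp add: funpow_add)
    then have fu: "(f ^^ (u + u)) p \<in> B S r" using s(1) by simp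
    \<comment> \<open>otherwise \<open>c\<^sup>2 lam\<^sup>m \<ge> (c lam\<^sup>u)\<^sup>2 \<ge> 1\<close>, although the choice of \<open>m\<close> makes it at most \<open>1/2\<close>\<close>
    have "2 * u < m"
    proof (rule ccontr)
      assume "\<not> 2 * u < m"
      then have ge: "lam ^ (2 * u) \<le> lam ^ m" using lam by (intro power_decreasing) auto
      have one: "1 \<le> c * lam ^ u" using Lu lam by (simp add: c)
      have "1 * 1 \<le> (c * lam ^ u) * (c * lam ^ u)" using one by (intro mult_mono) auto
      also have "\<dots> = (c * c) * lam ^ (2 * u)" by (simp add: mult_2 power_add)
      also have "\<dots> \<le> (c * c) * lam ^ m" using ge c1 by (intro mult_left_mono) auto
      also have "\<dots> = c * (c * lam ^ m)" by simp
      also have "\<dots> \<le> c * (1 / (2 * c))" using m(2) c1 by (intro mult_left_mono) auto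
      also have "\<dots> = 1 / 2" using c1 by simp
      finally show False by simp
    qed
    then obtain k where k: "m = Suc k" "2 * u \<le> k" by (cases m) auto
    have future: "(f ^^ (n + k)) p \<in> B S r" for n
    proof -
      have "n + k = (n + k - (u + u)) + (u + u)" using k by simp
      then have "f ^^ (n + k) = f ^^ (n + k - (u + u)) \<circ> f ^^ (u + u)" by (metis funpow_add)
      then show ?thesis using invS[OF fu] by simp
    qed

    assume "shift_invariant usphere d f \<delta> (shadow_map usphere f m br)"
    then obtain \<delta>' where \<delta>': "0 < \<delta>'" "\<delta>' \<le> \<delta>"
      and equi: "\<And>x. x \<in> pseudo_orbits usphere d f \<delta>' \<Longrightarrow> shadow_map usphere f m br (shift x) = f (shadow_map usphere f m br x)"
      unfolding shift_invariant_def by blast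
    obtain q where q: "q \<in> usphere" "q \<noteq> p" "d q p \<le> \<delta>'"
      using nearby_point_on_sphere[OF p dim2 ab(2) upper \<delta>'(1)] commute[OF p] by metis
    define x where "x = (\<lambda>i. zpow usphere f i (if i < 0 then p else q))"
    have x\<delta>': "x \<in> pseudo_orbits usphere d f \<delta>'"
      unfolding x_def by (rule inv.jump_pseudo_orbit) (use f_inv refl p q \<delta>' in auto)
    then have x\<delta>: "x \<in> pseudo_orbits usphere d f \<delta>" using \<delta>'(2) order_trans unfolding pseudo_orbits_def by blast
    note jump = inv.shadow_map_of_jump[OF f_inv delta(3)[unfolded k(1)] idem br_N br_S p past future q(1) x_def x\<delta>]
    have "shadow_map usphere f m br x = q" unfolding k(1) by (rule jump)
    moreover have "shadow_map usphere f m br (\<lambda>i. x (i + - 1)) = f_inv p" unfolding k(1) by (rule jump)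
    moreover have "shift (\<lambda>i. x (i + - 1)) = x" by (simp add: shift_def)
    ultimately have "q = f (f_inv p)" using equi[OF pseudo_orbits_shift[OF x\<delta>', of "- 1"]] by simp
    then show False using q(2) inv.F_F'[OF p] by simp
  qed
  ultimately show ?thesis by blast
qed

end
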